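(* Let $(G,\sigma)$ be a connected signed simple graph of maximum degree $3$ which is not (switching) isomorphic to $(K_4,-)$. Then $\chi_c(G,\sigma)\le \frac{10}{3}$.
   Context: A signed graph $(G,\sigma)$ is a graph $G$ with a sign assignment $\sigma:E(G)\to\{+,-\}$; $(K_4,-)$ denotes $K_4$ with all edges negative. Switching a vertex reverses the signs of all edges incident to it; two signed graphs are switching equivalent if one is obtained from the other by switching a set of vertices, and "(switching) isomorphic" means isomorphic after a switching. For integers $p\ge 2q>0$ with $p$ even, the signed circular clique $K^s_{p;q}$ has vertex set $\{0,1,\dots,p-1\}$, where $ij$ (with $i\ne j$ or $i=j$) is a negative edge iff $q\le |i-j|\le p-q$, and a positive edge iff $|i-j|\le \frac p2-q$ or $|i-j|\ge \frac p2+q$ (so every vertex has a positive loop). An edge-sign preserving homomorphism of $(G,\sigma)$ to $(H,\pi)$ is a map $f:V(G)\to V(H)$ such that each edge $uv$ is mapped to an edge $f(u)f(v)$ with $\pi(f(u)f(v))=\sigma(uv)$. A signed graph with no negative loop admits a circular $\frac pq$-coloring if it has an edge-sign preserving homomorphism to $K^s_{p;q}$, and its circular chromatic number is $\chi_c(G,\sigma)=\inf\{\frac pq : (G,\sigma)\text{ has an edge-sign preserving homomorphism to } K^s_{p;q}\}$. *)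

theory Defs
  imports Complex_Main
begin

datatype edge_sgn = Pos | Neg

fun flip :: "edge_sgn \<Rightarrow> edge_sgn" where
  "flip Pos = Neg"
| "flip Neg = Pos"

text \<open>Edges have their own type, so that parallel edges are possible (circular cliques have
  parallel edges of opposite signs). The set of ends of an edge has two elements, or one if the
  edge is a loop.\<close>

record ('v, 'e) signed_graph =
  vertices :: "'v set"
  edges :: "'e set"
  ends :: "'e \<Rightarrow> 'v set"
  edge_sign :: "'e \<Rightarrow> edge_sgn"

definition wf_signed_graph :: "('v, 'e) signed_graph \<Rightarrow> bool" where
  "wf_signed_graph G \<longleftrightarrow>
     finite (vertices G) \<and> finite (edges G) \<and>
     (\<forall>e\<in>edges G. ends G e \<subseteq> vertices G \<and> card (ends G e) \<in> {1, 2})"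

definition simple_signed_graph :: "('v, 'e) signed_graph \<Rightarrow> bool" where
  "simple_signed_graph G \<longleftrightarrow>
     wf_signed_graph G \<and> (\<forall>e\<in>edges G. card (ends G e) = 2) \<and> inj_on (ends G) (edges G)"

definition adj_rel :: "('v, 'e) signed_graph \<Rightarrow> ('v \<times> 'v) set" where
  "adj_rel G = {(u, v). \<exists>e\<in>edges G. ends G e = {u, v}}"

definition connected_signed_graph :: "('v, 'e) signed_graph \<Rightarrow> bool" where
  "connected_signed_graph G \<longleftrightarrow>
     vertices G \<noteq> {} \<and> (\<forall>u\<in>vertices G. \<forall>v\<in>vertices G. (u, v) \<in> (adj_rel G)\<^sup>*)"

text \<open>Loops count twice.\<close>

definition vertex_degree :: "('v, 'e) signed_graph \<Rightarrow> 'v \<Rightarrow> nat" where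
  "vertex_degree G v =
     card {e \<in> edges G. v \<in> ends G e} + card {e \<in> edges G. ends G e = {v}}"

definition max_degree :: "('v, 'e) signed_graph \<Rightarrow> nat" where
  "max_degree G = Max (vertex_degree G ` vertices G)"

text \<open>Switching all vertices of \<open>S\<close>, one after the other: an edge is reversed in total iff exactly
  one of its ends lies in \<open>S\<close>. Loops are never changed, as both of their ends are switched
  (the usual convention, immaterial for simple graphs).\<close>

definition switch :: "'v set \<Rightarrow> ('v, 'e) signed_graph \<Rightarrow> ('v, 'e) signed_graph" where
  "switch S G = G\<lparr>edge_sign := \<lambda>e.
     if (\<exists>u\<in>ends G e. \<exists>v\<in>ends G e. u \<in> S \<and> v \<notin> S)
     then flip (edge_sign G e) else edge_sign G e\<rparr>"

definition isomorphic_signed_graph ::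
  "('v, 'e) signed_graph \<Rightarrow> ('w, 'f) signed_graph \<Rightarrow> bool" where
  "isomorphic_signed_graph G H \<longleftrightarrow>
     (\<exists>f g. bij_betw f (vertices G) (vertices H) \<and> bij_betw g (edges G) (edges H) \<and>
        (\<forall>e\<in>edges G. ends H (g e) = f ` ends G e \<and> edge_sign H (g e) = edge_sign G e))"

definition switching_isomorphic ::
  "('v, 'e) signed_graph \<Rightarrow> ('w, 'f) signed_graph \<Rightarrow> bool" where
  "switching_isomorphic G H \<longleftrightarrow>
     (\<exists>S\<subseteq>vertices G. isomorphic_signed_graph (switch S G) H)"

definition K4_neg :: "(nat, nat set) signed_graph" where
  "K4_neg = \<lparr>vertices = {0..<4}, edges = {e. e \<subseteq> {0..<4} \<and> card e = 2},
     ends = (\<lambda>e. e), edge_sign = (\<lambda>_. Neg)\<rparr>"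

text \<open>An edge of a circular clique is identified by its ends together with its sign. The
  definition is meant for even \<open>p\<close> with \<open>p \<ge> 2 * q > 0\<close>, so that \<open>p div 2\<close> is exact.\<close>

definition circular_clique :: "int \<Rightarrow> int \<Rightarrow> (int, int set \<times> edge_sgn) signed_graph" where
  "circular_clique p q = \<lparr>vertices = {0..<p},
     edges =
       {({i, j}, Neg) | i j. i \<in> {0..<p} \<and> j \<in> {0..<p} \<and> q \<le> \<bar>i - j\<bar> \<and> \<bar>i - j\<bar> \<le> p - q} \<union>
       {({i, j}, Pos) | i j. i \<in> {0..<p} \<and> j \<in> {0..<p} \<and>
          (\<bar>i - j\<bar> \<le> p div 2 - q \<or> \<bar>i - j\<bar> \<ge> p div 2 + q)},
     ends = fst, edge_sign = snd\<rparr>"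

definition sign_preserving_hom ::
  "('v, 'e) signed_graph \<Rightarrow> ('w, 'f) signed_graph \<Rightarrow> ('v \<Rightarrow> 'w) \<Rightarrow> bool" where
  "sign_preserving_hom G H f \<longleftrightarrow>
     f ` vertices G \<subseteq> vertices H \<and>
     (\<forall>e\<in>edges G. \<exists>e'\<in>edges H. ends H e' = f ` ends G e \<and> edge_sign H e' = edge_sign G e)"

definition circular_ratios :: "('v, 'e) signed_graph \<Rightarrow> real set" where
  "circular_ratios G = {real_of_int p / real_of_int q | p q.
     even p \<and> p \<ge> 2 * q \<and> q > 0 \<and> (\<exists>f. sign_preserving_hom G (circular_clique p q) f)}"

definition circular_chromatic_number :: "('v, 'e) signed_graph \<Rightarrow> real" where
  "circular_chromatic_number G = Inf (circular_ratios G)"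

lemma edge_sign_switch_insert:
  assumes "wf_signed_graph G" "e \<in> edges G" "v \<notin> S"
  shows "edge_sign (switch (insert v S) G) e = edge_sign (switch {v} (switch S G)) e"
proof -
  have flip2: "flip (flip s) = s" for s by (cases s) auto
  have "card (ends G e) \<in> {1, 2}" using assms by (simp add: wf_signed_graph_def)
  then obtain a b where "ends G e = {a, b}"
    by (auto simp: card_1_singleton_iff card_2_iff)
  then show ?thesis using assms(3) by (auto simp: switch_def flip2)
qed

lemma wf_circular_clique: "wf_signed_graph (circular_clique p q)"
proof -
  have "edges (circular_clique p q) \<subseteq> Pow {0..<p} \<times> {Pos, Neg}"
    by (auto simp: circular_clique_def)
  then have "finite (edges (circular_clique p q))"
    by (rule finite_subset) auto
  then show ?thesis
    unfolding wf_signed_graph_def by (auto simp: circular_clique_def card_insert_if split: if_splits)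
qed

text \<open>For simple graphs the infimum is over a nonempty set bounded below, so the convention for
  the infimum of other sets of reals does not matter.\<close>

lemma circular_ratios_bdd_below: "bdd_below (circular_ratios G)"
proof (rule bdd_belowI[of _ 2])
  fix x assume "x \<in> circular_ratios G"
  then obtain p q :: int where x: "x = real_of_int p / real_of_int q" and pq: "p \<ge> 2 * q" "q > 0"
    by (auto simp: circular_ratios_def)
  have "real_of_int (2 * q) \<le> real_of_int p" using pq by (simp only: of_int_le_iff)
  then show "2 \<le> x" unfolding x using pq by (intro mult_imp_le_div_pos) auto
qed

lemma circular_ratios_nonempty:
  assumes G: "simple_signed_graph G" and ne: "vertices G \<noteq> {}"
  shows "circular_ratios G \<noteq> {}"
proof -
  define n where "n = int (card (vertices G))"
  have fin: "finite (vertices G)"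
    using G by (simp add: simple_signed_graph_def wf_signed_graph_def)
  then have n: "n > 0" using ne by (simp add: n_def card_gt_0_iff)
  obtain h where h: "bij_betw h (vertices G) {0..<card (vertices G)}"
    using ex_bij_betw_finite_nat[OF fin] by blast
  define f where "f v = int (h v)" for v
  have f: "0 \<le> f v" "f v < n" if "v \<in> vertices G" for v
    using h that by (auto simp: f_def n_def bij_betw_def)
  have inj: "f u \<noteq> f v" if "u \<in> vertices G" "v \<in> vertices G" "u \<noteq> v" for u v
    using h that by (auto simp: f_def bij_betw_def inj_on_def)
  have "\<exists>e'\<in>edges (circular_clique (2 * n) 1).
      ends (circular_clique (2 * n) 1) e' = f ` ends G e \<and>
      edge_sign (circular_clique (2 * n) 1) e' = edge_sign G e" if e: "e \<in> edges G" for e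
  proof -
    obtain u v where uv: "ends G e = {u, v}" "u \<noteq> v" "u \<in> vertices G" "v \<in> vertices G"
      using G e by (fastforce simp: simple_signed_graph_def wf_signed_graph_def card_2_iff)
    have "1 \<le> \<bar>f u - f v\<bar>" "\<bar>f u - f v\<bar> \<le> n - 1"
      using f[OF uv(3)] f[OF uv(4)] inj[OF uv(3,4,2)] by auto
    then have "({f u, f v}, edge_sign G e) \<in> edges (circular_clique (2 * n) 1)"
      using f[OF uv(3)] f[OF uv(4)] 
      by (cases "edge_sign G e") (force simp: circular_clique_def)+
    then show ?thesis
      using uv(1) by (intro bexI) (auto simp: circular_clique_def)
  qed
  then have "sign_preserving_hom G (circular_clique (2 * n) 1) f"
    using f by (fastforce simp: sign_preserving_hom_def circular_clique_def)
  then have "real_of_int (2 * n) / real_of_int 1 \<in> circular_ratios G"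
    using n unfolding circular_ratios_def by (intro CollectI exI[of _ "2 * n"] exI[of _ 1]) auto
  then show ?thesis by blast
qed

end

theory Submission
  imports Defs
begin

text \<open>Colours are integers modulo 10: the ends of a positive edge must be at circular distance at most
  2, those of a negative edge at distance at least 3, and switching a vertex adds 5 to its colour.
  We colour every subcubic signed graph that contains no negative \<open>K\<^sub>4\<close>, by induction on the
  number of vertices.

  If there is a triangle, colour the graph without it. A triangle vertex has at most one neighbour
  outside, which leaves it an arc of five consecutive colours. A positive triangle can always be
  coloured from such arcs. An all-negative one can be, unless the centres of the arcs are pairwise at
  distance at most 1. This is avoided by adding an edge between two outer neighbours (which must not
  create a negative \<open>K\<^sub>4\<close>), or by deleting some outer neighbours as well if they coincide
  or are adjacent.

  If there is no triangle, switch so that the number of negative edges is least. Comparing signs on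
  the cuts around single vertices and around positive paths with three vertices shows that the
  negative edges form a matching and that every matched vertex has at most one matched positive
  neighbour. Call one end of each negative edge low and the other one high, with as few
  positive edges between low and high vertices as possible. Reversing a negative edge shows that
  at most one of its ends lies on such a positive edge. Unmatched vertices get colour 2, low vertices
  0, high vertices 4, except that the ends of a positive low-high edge get 1 and 3.\<close>

subsection \<open>Colouring triangles from arcs of five colours\<close>

text \<open>The window of differences from -2 to 2 is shifted to start at 0, so that one comparison
  decides it. Colours stay unreduced integers, which makes switching a plain addition of 5; they are
  reduced only in \<open>coloring_imp_hom\<close>.\<close>

definition near :: "int \<Rightarrow> int \<Rightarrow> bool" where
  "near x y \<longleftrightarrow> (x - y + 2) mod 10 \<le> 4"

lemma mod_10_mem: "(x::int) mod 10 \<in> {0, 1, 2, 3, 4, 5, 6, 7, 8, 9}"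
proof -
  have "x mod 10 = 0 + int (nat (x mod 10))" "nat (x mod 10) < 10" by auto
  moreover have "n \<in> {0, 1, 2, 3, 4, 5, 6, 7, 8, 9}" if "n < 10" for n :: nat
    using that by (auto simp: eval_nat_numeral less_Suc_eq)
  ultimately show ?thesis by fastforce
qed

lemma near_iff_mod: "near x y \<longleftrightarrow> ((x - y) mod 10 + 2) mod 10 \<le> 4"
  unfolding near_def by (simp add: mod_add_left_eq)

lemma near_sym: "near x y \<longleftrightarrow> near y x"
proof -
  have "(y - x) mod 10 = (- ((x - y) mod 10)) mod 10"
    by (simp add: mod_minus_eq)
  then show ?thesis
    unfolding near_iff_mod using mod_10_mem[of "x - y"] by auto
qed

text \<open>Switching rests on this: the five differences from -2 to 2 and their translates by 5
  partition the residues modulo 10.\<close>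

lemma near_antipode [simp]: "near (x + 5) y \<longleftrightarrow> \<not> near x y" "near x (y + 5) \<longleftrightarrow> \<not> near x y"
proof -
  have left: "near (x + 5) y \<longleftrightarrow> \<not> near x y" for x y
  proof -
    have "((x - y) mod 10 + 5) mod 10 = (x + 5 - y) mod 10"
      unfolding mod_add_left_eq by (simp add: algebra_simps)
    then show ?thesis
      unfolding near_iff_mod using mod_10_mem[of "x - y"] by auto
  qed
  show "near (x + 5) y \<longleftrightarrow> \<not> near x y" "near x (y + 5) \<longleftrightarrow> \<not> near x y"
    using left near_sym by blast+
qed

lemma near_translate [simp]:
  "near (x + i) (x + j) \<longleftrightarrow> near i j" "near x (x + j) \<longleftrightarrow> near 0 j" "near (x + i) x \<longleftrightarrow> near i 0"
  by (simp_all add: near_def)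

lemma near_iff_offset: "near (a + i) b \<longleftrightarrow> near i ((b - a) mod 10)"
proof -
  have "(i + 2 - (b - a) mod 10) mod 10 = (i + 2 - (b - a)) mod 10"
    by (rule mod_diff_right_eq)
  then have "(i - (b - a) mod 10 + 2) mod 10 = (a + i - b + 2) mod 10"
    by (simp add: algebra_simps)
  then show ?thesis by (simp add: near_def)
qed

text \<open>Of two antipodal points exactly one is near \<open>c\<close>. So it suffices to give two triples whose third
  entries are antipodal, each suitable for the lists around \<open>a\<close> and \<open>b\<close>.\<close>

lemma antipodal_choice: "near r c \<or> near (r + 5) c"
  by simp

lemma positive_triangle_lists_aux:
  assumes "(b - a) mod 10 \<le> 3"
  shows "\<exists>p q r. near p a \<and> near q b \<and> near r c \<and> near p q \<and> near q r \<and> near p r"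
proof -
  define k where "k = (b - a) mod 10"
  have "0 \<le> k" "k \<le> 3" using assms by (simp_all add: k_def)
  then have "k \<in> {0, 1, 2, 3}" by auto
  \<comment> \<open>The arc around \<open>b\<close> contains \<open>a + 1\<close> for offsets -1 to
    3 and \<open>a + 2\<close> for offsets 0 to 4, so 0 to 3 allow both. The first two vertices can
    share one of these: \<open>a + 1\<close> goes with \<open>a + (-1)\<close> at the third vertex,
    \<open>a + 2\<close> with the antipode \<open>a + 4\<close>.\<close>
  then have "near (a + 2) b" "near (a + 1) b"
    unfolding near_iff_offset k_def[symmetric] by (auto simp: near_def)
  moreover have "near (a + (-1)) c \<or> near (a + 4) c"
    using antipodal_choice[of "a + (-1)" c] by (simp add: add.commute)
  ultimately show ?thesis
  proof (elim disjE)
    assume "near (a + (-1)) c"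
    with \<open>near (a + 1) b\<close> show ?thesis
      by (intro exI[of _ "a + 1"] exI[of _ "a + (-1)"] conjI) (simp_all only: near_translate, simp_all add: near_def)
  next
    assume "near (a + 4) c"
    with \<open>near (a + 2) b\<close> show ?thesis
      by (intro exI[of _ "a + 2"] exI[of _ "a + 4"] conjI) (simp_all only: near_translate, simp_all add: near_def)
  qed
qed

text \<open>Three centres on a circle of length 10 leave a gap of at most 3 between some two
  cyclically consecutive ones. The conclusion is symmetric in the three vertices, so that pair can
  play the roles of \<open>a\<close> and \<open>b\<close>.\<close>

lemma positive_triangle_lists:
  "\<exists>p q r. near p a \<and> near q b \<and> near r c \<and> near p q \<and> near q r \<and> near p r"
proof -
  define k l where "k = (b - a) mod 10" and "l = (c - a) mod 10"
  have bc: "(c - b) mod 10 = (l - k) mod 10" "(b - c) mod 10 = (k - l) mod 10"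
    unfolding k_def l_def by (simp_all add: mod_diff_eq)
  have a: "(a - b) mod 10 = (- k) mod 10" "(a - c) mod 10 = (- l) mod 10"
    unfolding k_def l_def by (simp_all add: mod_minus_eq)
  have "k \<in> {0, 1, 2, 3, 4, 5, 6, 7, 8, 9}" "l \<in> {0, 1, 2, 3, 4, 5, 6, 7, 8, 9}"
    unfolding k_def l_def by (rule mod_10_mem)+
  then have "k \<le> 3 \<or> (- k) mod 10 \<le> 3 \<or> l \<le> 3 \<or> (- l) mod 10 \<le> 3 \<or>
      (l - k) mod 10 \<le> 3 \<or> (k - l) mod 10 \<le> 3"
    by auto
  then consider "(b - a) mod 10 \<le> 3" | "(a - b) mod 10 \<le> 3" | "(b - c) mod 10 \<le> 3"
    | "(c - b) mod 10 \<le> 3" | "(a - c) mod 10 \<le> 3" | "(c - a) mod 10 \<le> 3"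
    unfolding bc a k_def l_def by blast
  then show ?thesis
    by cases (drule positive_triangle_lists_aux, use near_sym in blast)+
qed

lemma negative_triangle_lists_aux:
  assumes "2 \<le> (b - a) mod 10" "(b - a) mod 10 \<le> 5"
  shows "\<exists>p q r. near p a \<and> near q b \<and> near r c \<and> \<not> near p q \<and> \<not> near q r \<and> \<not> near p r"
proof -
  define k where "k = (b - a) mod 10"
  have "2 \<le> k" "k \<le> 5" using assms by (simp_all add: k_def)
  then have "k \<in> {2, 3, 4, 5}" by auto
  \<comment> \<open>The arc around \<open>b\<close> contains \<open>a + 3\<close> for offsets 1 to 5
    and \<open>a + 4\<close> for offsets 2 to 6. The triples -2, 4, 1 and 0, 3, 6 (relative to
    \<open>a\<close>) have all mutual distances at least 3, and their third entries are
    antipodal.\<close>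
  then have "near (a + 3) b" "near (a + 4) b"
    unfolding near_iff_offset k_def[symmetric] by (auto simp: near_def)
  moreover have "near (a + 1) c \<or> near (a + 6) c"
    using antipodal_choice[of "a + 1" c] by (simp add: add.commute)
  ultimately show ?thesis
  proof (elim disjE)
    assume "near (a + 1) c"
    with \<open>near (a + 4) b\<close> show ?thesis
      by (intro exI[of _ "a + (-2)"] exI[of _ "a + 4"] exI[of _ "a + 1"] conjI)
        (simp_all only: near_translate, simp_all add: near_def)
  next
    assume "near (a + 6) c"
    with \<open>near (a + 3) b\<close> show ?thesis
      by (intro exI[of _ "a + 0"] exI[of _ "a + 3"] exI[of _ "a + 6"] conjI)
        (simp_all only: near_translate, simp_all add: near_def)
  qed
qed

text \<open>Exchanging the first two vertices turns offsets 5 to 8 into 2 to 5, so the auxiliary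
  lemma covers both ranges. Nothing is asked of \<open>c\<close>, thanks to the antipodal choice at
  the third vertex.\<close>

lemma negative_triangle_lists:
  assumes "2 \<le> (a - b) mod 10" "(a - b) mod 10 \<le> 8"
  shows "\<exists>p q r. near p a \<and> near q b \<and> near r c \<and> \<not> near p q \<and> \<not> near q r \<and> \<not> near p r"
proof -
  have "(b - a) mod 10 = (- ((a - b) mod 10)) mod 10"
    by (simp add: mod_minus_eq)
  moreover have "(a - b) mod 10 \<in> {2, 3, 4, 5, 6, 7, 8}"
    using assms by auto
  ultimately consider "2 \<le> (b - a) mod 10" "(b - a) mod 10 \<le> 5"
    | "2 \<le> (a - b) mod 10" "(a - b) mod 10 \<le> 5"
    by auto
  then show ?thesis
    by cases (drule (1) negative_triangle_lists_aux, use near_sym in blast)+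
qed

text \<open>For two negative triangles that share the edge between \<open>q\<close> and
  \<open>r\<close>: the tips \<open>p\<close> and \<open>s\<close> are confined to arcs, while
  \<open>q\<close> and \<open>r\<close> are free because all their neighbours lie in the
  diamond.\<close>

lemma diamond_lists:
  "\<exists>p q r s. near p a \<and> near s b \<and> \<not> near q p \<and> \<not> near r p \<and> \<not> near q r \<and> \<not> near q s \<and> \<not> near r s"
proof -
  define k where "k = (b - a) mod 10"
  have "k \<in> {0, 1, 2, 3, 4, 5, 6, 7, 8, 9}"
    unfolding k_def by (rule mod_10_mem)
  \<comment> \<open>\<open>a + 2\<close> serves offsets 0 to 4, \<open>a + (-2)\<close> serves 6 to
    10, and \<open>a + 3\<close> the remaining offset 5. So the tips can share a colour or take
    \<open>a + 2\<close> and \<open>a + 3\<close>, which leaves room for two more colours far from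
    both and from each other.\<close>
  then have "near (a + 2) b \<or> near (a + 3) b \<or> near (a + (-2)) b"
    unfolding near_iff_offset k_def[symmetric] by (auto simp: near_def)
  then show ?thesis
  proof (elim disjE)
    assume "near (a + 2) b"
    then show ?thesis
      by (intro exI[of _ "a + 2"] exI[of _ "a + 6"] exI[of _ "a + 9"] conjI)
        (simp_all only: near_translate, simp_all add: near_def)
  next
    assume "near (a + 3) b"
    then show ?thesis
      by (intro exI[of _ "a + 2"] exI[of _ "a + 6"] exI[of _ "a + 9"] exI[of _ "a + 3"] conjI)
        (simp_all only: near_translate, simp_all add: near_def)
  next
    assume "near (a + (-2)) b"
    then show ?thesis
      by (intro exI[of _ "a + (-2)"] exI[of _ "a + 2"] exI[of _ "a + 5"] conjI)
        (simp_all only: near_translate, simp_all add: near_def)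
  qed
qed

text \<open>The conditions relating \<open>p\<close> and \<open>q\<close> amount to distance exactly
  2: close enough for a positive edge, yet far enough for the centres of two arcs of a negative
  triangle. The offsets are split as in \<open>diamond_lists\<close>.\<close>

lemma positive_edge_lists:
  "\<exists>p q. near p a \<and> near q b \<and> near p q \<and> 2 \<le> (p - q) mod 10 \<and> (p - q) mod 10 \<le> 8"
proof -
  define k where "k = (b - a) mod 10"
  have "k \<in> {0, 1, 2, 3, 4, 5, 6, 7, 8, 9}"
    unfolding k_def by (rule mod_10_mem)
  then have "near (a + 2) b \<or> near (a + 3) b \<or> near (a + (-2)) b"
    unfolding near_iff_offset k_def[symmetric] by (auto simp: near_def)
  then show ?thesis
  proof (elim disjE)
    assume "near (a + 2) b"
    then show ?thesis
      by (intro exI[of _ "a + 0"] exI[of _ "a + 2"] conjI)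
        (simp_all only: near_translate, simp_all add: near_def)
  next
    assume "near (a + 3) b"
    then show ?thesis
      by (intro exI[of _ "a + 1"] exI[of _ "a + 3"] conjI)
        (simp_all only: near_translate, simp_all add: near_def)
  next
    assume "near (a + (-2)) b"
    then show ?thesis
      by (intro exI[of _ "a + 0"] exI[of _ "a + (-2)"] conjI)
        (simp_all only: near_translate, simp_all add: near_def)
  qed
qed

subsection \<open>Colourings of signed graphs and switching\<close>

text \<open>A simple signed graph is given by its vertex set \<open>V\<close>, its adjacency relation \<open>E\<close> and a
  relation \<open>N\<close> that holds for the negative edges; only \<open>E\<close> on \<open>V\<close> and \<open>N\<close> on \<open>E\<close> matter. Relations
  on a fixed type make it easy to delete vertices and to add edges in the induction.\<close>

definition negative_triangle :: "('v \<Rightarrow> 'v \<Rightarrow> bool) \<Rightarrow> ('v \<Rightarrow> 'v \<Rightarrow> bool) \<Rightarrow> 'v \<Rightarrow> 'v \<Rightarrow> 'v \<Rightarrow> bool" where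
  "negative_triangle E N u v w \<longleftrightarrow> E u v \<and> E v w \<and> E u w \<and> (N u v \<noteq> (N v w \<noteq> N u w))"

definition subcubic :: "'v set \<Rightarrow> ('v \<Rightarrow> 'v \<Rightarrow> bool) \<Rightarrow> ('v \<Rightarrow> 'v \<Rightarrow> bool) \<Rightarrow> bool" where
  "subcubic V E N \<longleftrightarrow> finite V \<and> symp E \<and> irreflp E \<and> symp N \<and>
     (\<forall>x\<in>V. card {y\<in>V. E x y} \<le> 3)"

text \<open>Asking for four negative triangles instead of six negative edges makes the notion
  invariant under switching. For irreflexive \<open>E\<close>, adjacency forces the four vertices to
  be distinct.\<close>

definition has_K4_neg :: "'v set \<Rightarrow> ('v \<Rightarrow> 'v \<Rightarrow> bool) \<Rightarrow> ('v \<Rightarrow> 'v \<Rightarrow> bool) \<Rightarrow> bool" where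
  "has_K4_neg V E N \<longleftrightarrow> (\<exists>a\<in>V. \<exists>b\<in>V. \<exists>c\<in>V. \<exists>d\<in>V. negative_triangle E N a b c \<and>
     negative_triangle E N a b d \<and> negative_triangle E N a c d \<and> negative_triangle E N b c d)"

definition coloring :: "'v set \<Rightarrow> ('v \<Rightarrow> 'v \<Rightarrow> bool) \<Rightarrow> ('v \<Rightarrow> 'v \<Rightarrow> bool) \<Rightarrow> ('v \<Rightarrow> int) \<Rightarrow> bool" where
  "coloring V E N f \<longleftrightarrow> (\<forall>x\<in>V. \<forall>y\<in>V. E x y \<longrightarrow> (near (f x) (f y) \<longleftrightarrow> \<not> N x y))"

definition switch_rel :: "'v set \<Rightarrow> ('v \<Rightarrow> 'v \<Rightarrow> bool) \<Rightarrow> 'v \<Rightarrow> 'v \<Rightarrow> bool" where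
  "switch_rel S N x y \<longleftrightarrow> (N x y \<noteq> ((x \<in> S) \<noteq> (y \<in> S)))"

lemma subcubic_finite: "subcubic V E N \<Longrightarrow> finite V"
  by (simp add: subcubic_def)

lemma subcubic_sym: "subcubic V E N \<Longrightarrow> E x y \<longleftrightarrow> E y x"
  by (auto simp: subcubic_def symp_def)

lemma subcubic_sym_neg: "subcubic V E N \<Longrightarrow> N x y \<longleftrightarrow> N y x"
  by (auto simp: subcubic_def symp_def)

lemma subcubic_irrefl: "subcubic V E N \<Longrightarrow> \<not> E x x"
  by (auto simp: subcubic_def irreflp_def)

lemma subcubic_degree: "subcubic V E N \<Longrightarrow> x \<in> V \<Longrightarrow> card {y\<in>V. E x y} \<le> 3"
  by (auto simp: subcubic_def)

lemma subcubic_subset: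
  assumes "subcubic V E N" "U \<subseteq> V"
  shows "subcubic U E N"
proof -
  have "card {y\<in>U. E x y} \<le> 3" if "x \<in> U" for x
  proof -
    have "card {y\<in>U. E x y} \<le> card {y\<in>V. E x y}"
      using assms by (intro card_mono) (auto simp: subcubic_def)
    then show ?thesis
      using assms that subcubic_degree[of V E N x] by auto
  qed
  then show ?thesis
    using assms finite_subset by (auto simp: subcubic_def)
qed

lemma has_K4_neg_mono: "has_K4_neg U E N \<Longrightarrow> U \<subseteq> V \<Longrightarrow> has_K4_neg V E N"
  unfolding has_K4_neg_def by blast

lemma subcubic_no_four:
  assumes "subcubic V E N" "x \<in> V" "{a, b, c, d} \<subseteq> V" "E x a" "E x b" "E x c" "E x d"
    and "a \<noteq> b" "a \<noteq> c" "a \<noteq> d" "b \<noteq> c" "b \<noteq> d" "c \<noteq> d"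
  shows False
proof -
  have "card {a, b, c, d} \<le> card {y\<in>V. E x y}"
    using assms by (intro card_mono) (auto simp: subcubic_def)
  moreover have "card {a, b, c, d} = 4" using assms by simp
  ultimately show False using subcubic_degree[OF assms(1,2)] by simp
qed

lemma subcubic_switch_rel: "subcubic V E N \<Longrightarrow> subcubic V E (switch_rel S N)"
  unfolding subcubic_def symp_def switch_rel_def by metis

lemma negative_triangle_switch_rel:
  "negative_triangle E (switch_rel S N) u v w \<longleftrightarrow> negative_triangle E N u v w"
  unfolding negative_triangle_def switch_rel_def by auto

lemma has_K4_neg_switch_rel: "has_K4_neg V E (switch_rel S N) \<longleftrightarrow> has_K4_neg V E N"
  unfolding has_K4_neg_def negative_triangle_switch_rel by simp

lemma coloring_switch_rel:
  assumes "coloring V E (switch_rel S N) f"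
  shows "coloring V E N (\<lambda>x. if x \<in> S then f x + 5 else f x)"
  using assms unfolding coloring_def switch_rel_def by auto

lemma ex_coloring_switch_rel: "\<exists>f. coloring V E (switch_rel S N) f \<Longrightarrow> \<exists>f. coloring V E N f"
  using coloring_switch_rel by blast

lemma coloring_extend:
  assumes sub: "subcubic V E N" and g: "coloring (V - T) E N g"
    and inner: "\<And>x y. x \<in> T \<Longrightarrow> y \<in> T \<Longrightarrow> E x y \<Longrightarrow> near (h x) (h y) \<longleftrightarrow> \<not> N x y"
    and cross: "\<And>x y. x \<in> T \<Longrightarrow> y \<in> V - T \<Longrightarrow> E x y \<Longrightarrow> near (h x) (g y) \<longleftrightarrow> \<not> N x y"
  shows "coloring V E N (\<lambda>x. if x \<in> T then h x else g x)"
  unfolding coloring_def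
proof (intro ballI impI)
  fix x y assume xy: "x \<in> V" "y \<in> V" "E x y"
  have "near (h y) (g x) \<longleftrightarrow> \<not> N x y" if "y \<in> T" "x \<notin> T"
    using cross[of y x] that xy subcubic_sym[OF sub] subcubic_sym_neg[OF sub] by auto
  then show "near (if x \<in> T then h x else g x) (if y \<in> T then h y else g y) \<longleftrightarrow> \<not> N x y"
    using inner[of x y] cross[of x y] g xy near_sym by (auto simp: coloring_def)
qed

text \<open>Every colour in the arc of five colours around \<open>a\<close> can be given to \<open>x\<close> without conflict with
  the colours \<open>g\<close> of its neighbours in \<open>U\<close>.\<close>

definition list_center ::
  "'v set \<Rightarrow> ('v \<Rightarrow> 'v \<Rightarrow> bool) \<Rightarrow> ('v \<Rightarrow> 'v \<Rightarrow> bool) \<Rightarrow> ('v \<Rightarrow> int) \<Rightarrow> 'v \<Rightarrow> int \<Rightarrow> bool"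
  where "list_center U E N g x a \<longleftrightarrow> (\<forall>p. near p a \<longrightarrow> (\<forall>y\<in>U. E x y \<longrightarrow> (near p (g y) \<longleftrightarrow> \<not> N x y)))"

text \<open>A negative edge demands distance at least 3 from \<open>g y\<close>, that is, distance
  at most 2 from its antipode.\<close>

lemma list_center_one:
  assumes "\<And>y'. y' \<in> U \<Longrightarrow> E x y' \<Longrightarrow> y' = y"
  shows "list_center U E N g x (if N x y then g y + 5 else g y)"
  using assms unfolding list_center_def by auto

lemma ex_list_center:
  assumes "\<And>y y'. y \<in> U \<Longrightarrow> y' \<in> U \<Longrightarrow> E x y \<Longrightarrow> E x y' \<Longrightarrow> y = y'"
  shows "\<exists>a. list_center U E N g x a"
proof (cases "\<exists>y\<in>U. E x y")
  case True
  then obtain y where "y \<in> U" "E x y" by blast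
  then show ?thesis using list_center_one[of U E x y N g] assms by blast
next
  case False
  then show ?thesis by (auto simp: list_center_def)
qed

lemma triangle_outer_unique:
  assumes "subcubic V E N" "{u, v, w, y, y'} \<subseteq> V" "E u v" "E u w" "v \<noteq> w" "E u y" "E u y'"
    "y \<notin> {v, w}" "y' \<notin> {v, w}"
  shows "y = y'"
  using subcubic_no_four[of V E N u v w y y'] assms by auto

lemma coloring_triangle:
  assumes sub: "subcubic V E N" and g: "coloring (V - {u, v, w}) E N g"
    and "u \<noteq> v" "v \<noteq> w" "u \<noteq> w"
    and signs: "near p q \<longleftrightarrow> \<not> N u v" "near q r \<longleftrightarrow> \<not> N v w" "near p r \<longleftrightarrow> \<not> N u w"
    and lists: "list_center (V - {u, v, w}) E N g u a" "list_center (V - {u, v, w}) E N g v b"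
      "list_center (V - {u, v, w}) E N g w c" and "near p a" "near q b" "near r c"
  shows "\<exists>f. coloring V E N f"
proof -
  define h where "h = (\<lambda>x. if x = u then p else if x = v then q else r)"
  have "near (h x) (h y) \<longleftrightarrow> \<not> N x y" if "x \<in> {u, v, w}" "y \<in> {u, v, w}" "E x y" for x y
    using that assms(3-8) subcubic_irrefl[OF sub] subcubic_sym_neg[OF sub] near_sym
    unfolding h_def by auto
  moreover have "near (h x) (g y) \<longleftrightarrow> \<not> N x y" if "x \<in> {u, v, w}" "y \<in> V - {u, v, w}" "E x y" for x y
    using that assms(3-5,9-) unfolding h_def list_center_def by auto
  ultimately show ?thesis
    using coloring_extend[OF sub g] by blast
qed

lemma triangle_list_center:
  assumes sub: "subcubic V E N" and "{u, v, w} \<subseteq> V" "E u v" "E v w" "E u w"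
  shows "\<exists>a. list_center (V - {u, v, w}) E N g u a" "\<exists>a. list_center (V - {u, v, w}) E N g v a"
    "\<exists>a. list_center (V - {u, v, w}) E N g w a"
proof -
  have ne: "u \<noteq> v" "v \<noteq> w" "u \<noteq> w" using assms subcubic_irrefl[OF sub] by blast+
  have E: "E v u" "E w u" "E w v" using assms subcubic_sym[OF sub] by blast+
  show "\<exists>a. list_center (V - {u, v, w}) E N g u a"
    by (rule ex_list_center, rule triangle_outer_unique[OF sub, of u v w]) (use assms ne E in auto)
  show "\<exists>a. list_center (V - {u, v, w}) E N g v a"
    by (rule ex_list_center, rule triangle_outer_unique[OF sub, of v u w]) (use assms ne E in auto)
  show "\<exists>a. list_center (V - {u, v, w}) E N g w a"
    by (rule ex_list_center, rule triangle_outer_unique[OF sub, of w u v]) (use assms ne E in auto)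
qed

lemma positive_triangle_reducible:
  assumes sub: "subcubic V E N" and V: "{u, v, w} \<subseteq> V" and E: "E u v" "E v w" "E u w"
    and pos: "\<not> negative_triangle E N u v w"
    and smaller: "\<And>N. subcubic (V - {u, v, w}) E N \<Longrightarrow> \<not> has_K4_neg (V - {u, v, w}) E N \<Longrightarrow>
      \<exists>f. coloring (V - {u, v, w}) E N f"
    and K4: "\<not> has_K4_neg V E N"
  shows "\<exists>f. coloring V E N f"
proof -
  have ne: "u \<noteq> v" "v \<noteq> w" "u \<noteq> w" using E subcubic_irrefl[OF sub] by blast+
  \<comment> \<open>Switching these vertices makes \<open>uv\<close> and \<open>vw\<close> positive;
    the third edge follows because switching preserves the sign of a triangle.\<close>
  define S where "S = {x. x = u \<and> N u v \<or> x = w \<and> N v w}"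
  define M where "M = switch_rel S N"
  have signs: "\<not> M u v" "\<not> M v w" "\<not> M u w"
    using ne pos E by (auto simp: M_def S_def switch_rel_def negative_triangle_def)
  have subM: "subcubic V E M" unfolding M_def by (rule subcubic_switch_rel[OF sub])
  have "\<not> has_K4_neg (V - {u, v, w}) E M"
    using K4 has_K4_neg_mono[of "V - {u, v, w}" E M V] by (auto simp: M_def has_K4_neg_switch_rel)
  then obtain g where g: "coloring (V - {u, v, w}) E M g"
    using smaller[of M] subcubic_subset[OF subM] by auto
  obtain a b c where lists: "list_center (V - {u, v, w}) E M g u a"
    "list_center (V - {u, v, w}) E M g v b" "list_center (V - {u, v, w}) E M g w c"
    using triangle_list_center[OF subM V E] by metis
  obtain p q r where "near p a" "near q b" "near r c" "near p q" "near q r" "near p r"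
    using positive_triangle_lists by blast
  then have "\<exists>f. coloring V E M f"
    using coloring_triangle[OF subM g ne _ _ _ lists] signs by blast
  then show ?thesis
    unfolding M_def by (rule ex_coloring_switch_rel)
qed

text \<open>Two centres at distance at least 2 suffice, since \<open>negative_triangle_lists\<close>
  accepts any arc for the remaining vertex, here \<open>v\<close>. The reductions below arrange this
  distance.\<close>

lemma negative_triangle_extend:
  assumes sub: "subcubic V E N" and V: "{u, v, w} \<subseteq> V" and E: "E u v" "E v w" "E u w"
    and N: "N u v" "N v w" "N u w"
    and g: "coloring (V - {u, v, w}) E N g"
    and lists: "list_center (V - {u, v, w}) E N g u a" "list_center (V - {u, v, w}) E N g w b"
    and ab: "2 \<le> (a - b) mod 10" "(a - b) mod 10 \<le> 8"
  shows "\<exists>f. coloring V E N f"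
proof -
  have ne: "u \<noteq> v" "v \<noteq> w" "u \<noteq> w" using E subcubic_irrefl[OF sub] by blast+
  obtain c where c: "list_center (V - {u, v, w}) E N g v c"
    using triangle_list_center[OF sub V E] by metis
  obtain p q r where "near p a" "near q b" "near r c" "\<not> near p q" "\<not> near q r" "\<not> near p r"
    using negative_triangle_lists[OF ab] by blast
  then show ?thesis
    using coloring_triangle[OF sub g ne _ _ _ lists(1) c lists(2), of p r q] N near_sym by blast
qed

subsection \<open>Reducing triangles\<close>

text \<open>Ends of a negative edge are even 3 apart; the bounds are weakened to the form that
  \<open>negative_triangle_lists\<close> takes.\<close>

lemma not_near_mod:
  assumes "\<not> near s t"
  shows "2 \<le> (s - t) mod 10" "(s - t) mod 10 \<le> 8"
  using assms mod_10_mem[of "s - t"] unfolding near_iff_mod by auto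

text \<open>The induction hypothesis. It ranges over all relations on smaller sets, not only over
  subgraphs, because one reduction adds an edge.\<close>

definition colorable_below :: "'v set \<Rightarrow> bool" where
  "colorable_below V \<longleftrightarrow> (\<forall>(U :: 'v set) E N. card U < card V \<longrightarrow> subcubic U E N \<longrightarrow>
     \<not> has_K4_neg U E N \<longrightarrow> (\<exists>f. coloring U E N f))"

lemma colorable_below_subset:
  assumes "colorable_below V" "subcubic V E N" "\<not> has_K4_neg V E N" "u \<in> T" "u \<in> V"
  shows "\<exists>f. coloring (V - T) E N f"
proof -
  have "card (V - T) < card V"
    using assms subcubic_finite by (intro psubset_card_mono) auto
  then show ?thesis
    using assms subcubic_subset[of V E N "V - T"] has_K4_neg_mono[of "V - T" E N V]
    unfolding colorable_below_def by blast
qed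

text \<open>A positive edge to the only outer neighbour puts the centre at that neighbour's colour.
  \<open>T\<close> is a separate variable so that the triangle may be listed in any order.\<close>

lemma list_center_triangle_neighbor:
  assumes sub: "subcubic V E N" and V: "{u, v, w, x} \<subseteq> V" and E: "E u v" "E u w" "v \<noteq> w"
    and x: "E u x" "x \<notin> {u, v, w}" "\<not> N u x" and T: "T = {u, v, w}"
  shows "list_center (V - T) E N g u (g x)"
proof -
  have "y = x" if "y \<in> V - T" "E u y" for y
    using triangle_outer_unique[OF sub, of u v w y x] assms that by auto
  then show ?thesis
    using list_center_one[of "V - T" E u x N g] x(3) by simp
qed

text \<open>The arcs at \<open>u\<close> and \<open>w\<close> are centred at the colours of
  \<open>x\<close> and \<open>y\<close>. A negative edge \<open>xy\<close> separates these enough.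
  If it is positive, \<open>x\<close> and \<open>y\<close> are deleted too; each has at most one
  neighbour left, hence an arc, and \<open>positive_edge_lists\<close> recolours them at distance
  2.\<close>

lemma negative_triangle_adjacent_pair_aux:
  assumes below: "colorable_below V" and sub: "subcubic V E N" and K4: "\<not> has_K4_neg V E N"
    and V: "{u, v, w} \<subseteq> V" and E: "E u v" "E v w" "E u w" and N: "N u v" "N v w" "N u w"
    and x: "x \<in> V - {u, v, w}" "E u x" "\<not> N u x" and y: "y \<in> V - {u, v, w}" "E w y" "\<not> N w y"
    and xy: "x \<noteq> y" "E x y"
  shows "\<exists>f. coloring V E N f"
proof -
  let ?T = "{u, v, w}"
  have ne: "u \<noteq> v" "v \<noteq> w" "u \<noteq> w" using E subcubic_irrefl[OF sub] by blast+
  have E': "E w u" "E w v" "E x u" "E y w" "E y x"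
    using E x y xy subcubic_sym[OF sub] by blast+
  have lists: "list_center (V - ?T) E N g u (g x)" "list_center (V - ?T) E N g w (g y)" for g
    by (rule list_center_triangle_neighbor[OF sub, of u v w x]; use V E ne x in auto)
      (rule list_center_triangle_neighbor[OF sub, of w u v y]; use V E' ne y in auto)
  note extend = negative_triangle_extend[OF sub V E N _ lists]
  show ?thesis
  proof (cases "N x y")
    case True
    obtain g where g: "coloring (V - ?T) E N g"
      using colorable_below_subset[OF below sub K4, of u ?T] V by blast
    with True xy x y have "\<not> near (g x) (g y)"
      unfolding coloring_def by blast
    then show ?thesis
      using extend[OF g] not_near_mod by blast
  next
    case False
    let ?U = "V - ?T - {x, y}"
    have "V - insert x (insert y ?T) = ?U" by auto
    then obtain h where h: "coloring ?U E N h"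
      using colorable_below_subset[OF below sub K4, of u "insert x (insert y ?T)"] V by auto
    have "\<exists>a. list_center ?U E N h x a"
      by (rule ex_list_center, rule triangle_outer_unique[OF sub, of x u y])
        (use x y V E' xy in auto)
    moreover have "\<exists>b. list_center ?U E N h y b"
      by (rule ex_list_center, rule triangle_outer_unique[OF sub, of y w x])
        (use x y V E' xy in auto)
    ultimately obtain a b where ab: "list_center ?U E N h x a" "list_center ?U E N h y b"
      by blast
    obtain p q where pq: "near p a" "near q b" "near p q" "2 \<le> (p - q) mod 10" "(p - q) mod 10 \<le> 8"
      using positive_edge_lists by blast
    let ?k = "\<lambda>z. if z = x then p else q"
    let ?g = "\<lambda>z. if z \<in> {x, y} then ?k z else h z"
    have "subcubic (V - ?T) E N" using sub subcubic_subset by blast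
    then have "coloring (V - ?T) E N ?g"
    proof (rule coloring_extend[OF _ h])
      fix s t assume "s \<in> {x, y}" "t \<in> {x, y}" "E s t"
      then show "near (?k s) (?k t) \<longleftrightarrow> \<not> N s t"
        using False pq subcubic_irrefl[OF sub] subcubic_sym_neg[OF sub] near_sym by auto
    next
      fix s t assume "s \<in> {x, y}" "t \<in> ?U" "E s t"
      then show "near (?k s) (h t) \<longleftrightarrow> \<not> N s t"
        using ab pq xy unfolding list_center_def by auto
    qed
    then show ?thesis
      using extend[of ?g] pq xy by auto
  qed
qed

text \<open>A new negative edge \<open>xy\<close> in the graph without the triangle forces the
  colours of \<open>x\<close> and \<open>y\<close> apart. Degrees do not grow, as \<open>x\<close>
  loses \<open>u\<close> and \<open>y\<close> loses \<open>w\<close>, and \<open>no_K4_minus\<close>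
  keeps the new edge from completing a negative \<open>K4\<close>.\<close>

lemma negative_triangle_nonadjacent_pair_aux:
  assumes below: "colorable_below V" and sub: "subcubic V E N" and K4: "\<not> has_K4_neg V E N"
    and V: "{u, v, w} \<subseteq> V" and E: "E u v" "E v w" "E u w" and N: "N u v" "N v w" "N u w"
    and x: "x \<in> V - {u, v, w}" "E u x" "\<not> N u x" and y: "y \<in> V - {u, v, w}" "E w y" "\<not> N w y"
    and xy: "x \<noteq> y" "\<not> E x y"
    and no_K4_minus: "\<And>p q. p \<in> V - {u, v, w} \<Longrightarrow> q \<in> V - {u, v, w} \<Longrightarrow> p \<noteq> q \<Longrightarrow> p \<noteq> x \<Longrightarrow> q \<noteq> x \<Longrightarrow>
      p \<noteq> y \<Longrightarrow> q \<noteq> y \<Longrightarrow> E x p \<Longrightarrow> E x q \<Longrightarrow> E y p \<Longrightarrow> E y q \<Longrightarrow> E p q \<Longrightarrow> False"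
  shows "\<exists>f. coloring V E N f"
proof -
  let ?T = "{u, v, w}"
  have ne: "u \<noteq> v" "v \<noteq> w" "u \<noteq> w" using E subcubic_irrefl[OF sub] by blast+
  have E': "E w u" "E w v" "E x u" "E y w" "\<not> E y x"
    using E x y xy subcubic_sym[OF sub] by blast+
  have lists: "list_center (V - ?T) E N g u (g x)" "list_center (V - ?T) E N g w (g y)" for g
    by (rule list_center_triangle_neighbor[OF sub, of u v w x]; use V E ne x in auto)
      (rule list_center_triangle_neighbor[OF sub, of w u v y]; use V E' ne y in auto)
  define F where "F = (\<lambda>s t. E s t \<or> {s, t} = {x, y})"
  define M where "M = (\<lambda>s t. N s t \<or> {s, t} = {x, y})"
  have F: "F s t \<longleftrightarrow> E s t" "M s t \<longleftrightarrow> N s t" if "{s, t} \<noteq> {x, y}" for s t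
    using that by (auto simp: F_def M_def)
  have Fsym: "F s t \<longleftrightarrow> F t s" for s t
    using subcubic_sym[OF sub] by (auto simp: F_def insert_commute)
  have "subcubic (V - ?T) F M"
    unfolding subcubic_def
  proof (intro conjI ballI)
    show "finite (V - ?T)" using subcubic_finite[OF sub] by simp
    show "symp F" using Fsym by (simp add: symp_def)
    show "symp M" using subcubic_sym_neg[OF sub] by (auto simp: symp_def M_def insert_commute)
    show "irreflp F" using subcubic_irrefl[OF sub] xy by (auto simp: irreflp_def F_def doubleton_eq_iff)
    fix s assume s: "s \<in> V - ?T"
    have fin: "finite {t\<in>V. E s t}" for s using subcubic_finite[OF sub] by simp
    \<comment> \<open>At an end \<open>s\<close> of the new edge, the new neighbour
      \<open>s'\<close> takes the place of the deleted neighbour \<open>t\<close>.\<close>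
    have new: "card {t\<in>V - ?T. F s t} \<le> 3" if "s \<in> V" "E s t" "t \<in> V" "t \<in> ?T" "{s, s'} = {x, y}" for s s' t
    proof -
      have "{t\<in>V - ?T. F s t} \<subseteq> insert s' ({t\<in>V. E s t} - {t})"
        using that by (auto simp: F_def doubleton_eq_iff)
      then have "card {t\<in>V - ?T. F s t} \<le> card (insert s' ({t\<in>V. E s t} - {t}))"
        using fin by (intro card_mono) auto
      also have "\<dots> \<le> Suc (card ({t\<in>V. E s t} - {t}))"
        using fin by (simp add: card_insert_if)
      also have "\<dots> = card {t\<in>V. E s t}"
        using fin that by (intro card_Suc_Diff1) auto
      finally show ?thesis using subcubic_degree[OF sub \<open>s \<in> V\<close>] by simp
    qed
    show "card {t\<in>V - ?T. F s t} \<le> 3"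
    proof (cases "s = x \<or> s = y")
      case True
      then show ?thesis
        using new[of x u y] new[of y w x] x y V E' by (auto simp: insert_commute)
    next
      case False
      then have "card {t\<in>V - ?T. F s t} \<le> card {t\<in>V. E s t}"
        using fin by (intro card_mono) (auto simp: F_def doubleton_eq_iff)
      then show ?thesis using subcubic_degree[OF sub, of s] s by simp
    qed
  qed
  moreover have "\<not> has_K4_neg (V - ?T) F M"
  proof
    assume "has_K4_neg (V - ?T) F M"
    then obtain a b c d where abcd: "a \<in> V - ?T" "b \<in> V - ?T" "c \<in> V - ?T" "d \<in> V - ?T"
      and nt: "negative_triangle F M a b c" "negative_triangle F M a b d"
        "negative_triangle F M a c d" "negative_triangle F M b c d"
      unfolding has_K4_neg_def by blast
    have irr: "\<not> F s s" for s
      using subcubic_irrefl[OF sub] xy by (auto simp: F_def doubleton_eq_iff)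
    have adj: "F a b" "F a c" "F a d" "F b c" "F b d" "F c d"
      using nt by (auto simp: negative_triangle_def)
    have dist: "a \<noteq> b" "a \<noteq> c" "a \<noteq> d" "b \<noteq> c" "b \<noteq> d" "c \<noteq> d"
      using adj irr by blast+
    \<comment> \<open>If the new edge were one of the six edges of a \<open>K4\<close>, the other
      two vertices would be adjacent common neighbours of \<open>x\<close> and \<open>y\<close> in
      the old graph.\<close>
    have no: "{s, t} \<noteq> {x, y}" if "{s, t, p, q} \<subseteq> V - ?T" "F s p" "F s q" "F t p" "F t q" "F p q"
        "s \<noteq> p" "s \<noteq> q" "t \<noteq> p" "t \<noteq> q" "p \<noteq> q" for s t p q
    proof
      assume st: "{s, t} = {x, y}"
      then have ne': "p \<noteq> x" "p \<noteq> y" "q \<noteq> x" "q \<noteq> y" using that by (auto simp: doubleton_eq_iff)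
      have "E s p" "E s q" "E t p" "E t q" "E p q"
        using that ne' by (auto simp: F_def doubleton_eq_iff)
      then have "E x p" "E x q" "E y p" "E y q" "E p q"
        using st by (auto simp: doubleton_eq_iff)
      then show False using no_K4_minus[of p q] that ne' by auto
    qed
    have "{a, b} \<noteq> {x, y}" "{a, c} \<noteq> {x, y}" "{a, d} \<noteq> {x, y}" "{b, c} \<noteq> {x, y}" "{b, d} \<noteq> {x, y}" "{c, d} \<noteq> {x, y}"
      using no[of a b c d] no[of a c b d] no[of a d b c] no[of b c a d] no[of b d a c] no[of c d a b]
        abcd adj dist Fsym by auto
    then have "negative_triangle E N a b c \<and> negative_triangle E N a b d \<and>
        negative_triangle E N a c d \<and> negative_triangle E N b c d"
      using nt F unfolding negative_triangle_def by simp
    then show False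
      using K4 abcd unfolding has_K4_neg_def by blast
  qed
  moreover have "card (V - ?T) < card V"
    using subcubic_finite[OF sub] V by (intro psubset_card_mono) auto
  ultimately obtain g where g: "coloring (V - ?T) F M g"
    using below unfolding colorable_below_def by blast
  have "coloring (V - ?T) E N g"
    unfolding coloring_def
  proof (intro ballI impI)
    fix s t assume st: "s \<in> V - ?T" "t \<in> V - ?T" "E s t"
    then have "{s, t} \<noteq> {x, y}" using xy E' by (auto simp: doubleton_eq_iff)
    then show "near (g s) (g t) \<longleftrightarrow> \<not> N s t"
      using g st F unfolding coloring_def by blast
  qed
  moreover have "\<not> near (g x) (g y)"
    using g x y unfolding coloring_def F_def M_def by blast
  ultimately show ?thesis
    using negative_triangle_extend[OF sub V E N _ lists] not_near_mod by blast
qed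

lemma negative_triangle_pair:
  assumes below: "colorable_below V" and sub: "subcubic V E N" and K4: "\<not> has_K4_neg V E N"
    and V: "{u, v, w} \<subseteq> V" and E: "E u v" "E v w" "E u w" and N: "N u v" "N v w" "N u w"
    and x: "x \<in> V - {u, v, w}" "E u x" and y: "y \<in> V - {u, v, w}" "E w y" and "x \<noteq> y"
    and no_K4_minus: "\<And>p q. p \<in> V - {u, v, w} \<Longrightarrow> q \<in> V - {u, v, w} \<Longrightarrow> p \<noteq> q \<Longrightarrow> p \<noteq> x \<Longrightarrow> q \<noteq> x \<Longrightarrow>
      p \<noteq> y \<Longrightarrow> q \<noteq> y \<Longrightarrow> E x p \<Longrightarrow> E x q \<Longrightarrow> E y p \<Longrightarrow> E y q \<Longrightarrow> E p q \<Longrightarrow> \<not> E x y \<Longrightarrow> False"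
  shows "\<exists>f. coloring V E N f"
proof -
  \<comment> \<open>Switching the outer neighbours makes \<open>ux\<close> and \<open>wy\<close>
    positive and leaves the triangle alone.\<close>
  define S where "S = {z. z = x \<and> N u x \<or> z = y \<and> N w y}"
  define M where "M = switch_rel S N"
  have subM: "subcubic V E M" and K4M: "\<not> has_K4_neg V E M"
    using subcubic_switch_rel[OF sub] K4 by (simp_all add: M_def has_K4_neg_switch_rel)
  have M: "M u v" "M v w" "M u w" "\<not> M u x" "\<not> M w y"
    using N x y \<open>x \<noteq> y\<close> by (auto simp: M_def S_def switch_rel_def)
  have "\<exists>f. coloring V E M f"
  proof (cases "E x y")
    case True
    then show ?thesis
      using negative_triangle_adjacent_pair_aux[OF below subM K4M V E M(1-3) x M(4) y M(5) \<open>x \<noteq> y\<close>]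
      by blast
  next
    case False
    then show ?thesis
      using negative_triangle_nonadjacent_pair_aux[OF below subM K4M V E M(1-3) x M(4) y M(5) \<open>x \<noteq> y\<close>]
        no_K4_minus by blast
  qed
  then show ?thesis
    unfolding M_def by (rule ex_coloring_switch_rel)
qed

text \<open>The four vertices are deleted together. Since \<open>u\<close> and \<open>w\<close> have
  all three neighbours inside, only the tips \<open>v\<close> and \<open>x\<close> are constrained
  from outside, each by at most one neighbour, and \<open>diamond_lists\<close> applies.\<close>

lemma negative_diamond_reducible:
  assumes below: "colorable_below V" and sub: "subcubic V E N" and K4: "\<not> has_K4_neg V E N"
    and V: "{u, v, w, x} \<subseteq> V" and E: "E u v" "E v w" "E u w" "E u x" "E w x"
    and vx: "v \<noteq> x" "\<not> E v x" and N: "N u v" "N v w" "N u w"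
    and nt: "negative_triangle E N u w x"
  shows "\<exists>f. coloring V E N f"
proof -
  \<comment> \<open>This makes \<open>ux\<close> negative; \<open>wx\<close> is then negative too,
    because the triangle \<open>uwx\<close> and its edge \<open>uw\<close> are.\<close>
  define S where "S = {z. z = x \<and> \<not> N u x}"
  define M where "M = switch_rel S N"
  have ne: "u \<noteq> v" "v \<noteq> w" "u \<noteq> w" "u \<noteq> x" "w \<noteq> x"
    using E subcubic_irrefl[OF sub] by blast+
  have E': "E v u" "E w v" "E w u" "E x u" "E x w" "\<not> E x v"
    using E vx subcubic_sym[OF sub] by blast+
  have subM: "subcubic V E M" and K4M: "\<not> has_K4_neg V E M"
    using subcubic_switch_rel[OF sub] K4 by (simp_all add: M_def has_K4_neg_switch_rel)
  have M: "M u v" "M v w" "M u w" "M u x" "M w x"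
    using N nt ne vx by (auto simp: M_def S_def switch_rel_def negative_triangle_def)
  then have M': "M v u" "M w v" "M w u" "M x u" "M x w"
    using subcubic_sym_neg[OF subM] by blast+
  let ?T = "{u, v, w, x}"
  obtain h where h: "coloring (V - ?T) E M h"
    using colorable_below_subset[OF below subM K4M, of u ?T] V by blast
  have "\<exists>a. list_center (V - ?T) E M h v a"
    by (rule ex_list_center, rule triangle_outer_unique[OF sub, of v u w]) (use V E E' ne in auto)
  moreover have "\<exists>a. list_center (V - ?T) E M h x a"
    by (rule ex_list_center, rule triangle_outer_unique[OF sub, of x u w]) (use V E E' ne in auto)
  ultimately obtain a b where ab: "list_center (V - ?T) E M h v a" "list_center (V - ?T) E M h x b"
    by blast
  have full: "\<not> E u y" "\<not> E w y" if "y \<in> V - ?T" for y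
    using that subcubic_no_four[OF sub, of u v w x y] subcubic_no_four[OF sub, of w v u x y]
      V E E' ne vx by auto
  obtain p q r s where pqrs: "near p a" "near s b" "\<not> near q p" "\<not> near r p" "\<not> near q r"
    "\<not> near q s" "\<not> near r s"
    using diamond_lists by blast
  then have pqrs': "\<not> near p q" "\<not> near p r" "\<not> near r q" "\<not> near s q" "\<not> near s r"
    using near_sym by blast+
  let ?k = "\<lambda>z. if z = v then p else if z = u then q else if z = w then r else s"
  have "coloring V E M (\<lambda>z. if z \<in> ?T then ?k z else h z)"
  proof (rule coloring_extend[OF subM h])
    fix y z assume "y \<in> ?T" "z \<in> ?T" "E y z"
    then show "near (?k y) (?k z) \<longleftrightarrow> \<not> M y z"
      using M M' ne vx E' pqrs pqrs' subcubic_irrefl[OF sub] by auto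
  next
    fix y z assume "y \<in> ?T" "z \<in> V - ?T" "E y z"
    then show "near (?k y) (h z) \<longleftrightarrow> \<not> M y z"
      using ab pqrs ne vx full unfolding list_center_def by auto
  qed
  then show ?thesis
    unfolding M_def using ex_coloring_switch_rel by blast
qed

text \<open>A vertex with no outer neighbour accepts every colour, so its centre may be chosen
  antipodal to the centre \<open>b\<close> at \<open>w\<close>.\<close>

lemma negative_triangle_free_vertex:
  assumes below: "colorable_below V" and sub: "subcubic V E N" and K4: "\<not> has_K4_neg V E N"
    and V: "{u, v, w} \<subseteq> V" and E: "E u v" "E v w" "E u w" and N: "N u v" "N v w" "N u w"
    and free: "\<And>y. y \<in> V \<Longrightarrow> y \<notin> {u, v, w} \<Longrightarrow> \<not> E u y"
  shows "\<exists>f. coloring V E N f"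
proof -
  obtain g where g: "coloring (V - {u, v, w}) E N g"
    using colorable_below_subset[OF below sub K4, of u "{u, v, w}"] V by blast
  obtain b where "list_center (V - {u, v, w}) E N g w b"
    using triangle_list_center[OF sub V E] by metis
  moreover have "list_center (V - {u, v, w}) E N g u (b + 5)"
    using free unfolding list_center_def by blast
  ultimately show ?thesis
    using negative_triangle_extend[OF sub V E N g] by fastforce
qed

text \<open>In an uncolourable graph all triangles are negative and each triangle vertex has an
  outer neighbour. If two of these coincide, there is a negative diamond or a negative
  \<open>K4\<close>. If they are distinct, the pairs \<open>x\<close>, \<open>y\<close> and
  \<open>x\<close>, \<open>z\<close> are both obstructed by adjacent common neighbours; these are
  the same two vertices, and one of them gets degree 4.\<close>

lemma triangle_reducible:
  assumes below: "colorable_below V" and sub: "subcubic V E N" and K4: "\<not> has_K4_neg V E N"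
    and V: "{u, v, w} \<subseteq> V" and E: "E u v" "E v w" "E u w"
  shows "\<exists>f. coloring V E N f"
proof (rule ccontr)
  assume no_col: "\<not> ?thesis"
  \<comment> \<open>This makes \<open>uv\<close> and \<open>vw\<close> negative; \<open>uw\<close>
    follows once the triangle is known to be negative.\<close>
  define S where "S = {x. x = u \<and> \<not> N u v \<or> x = w \<and> \<not> N v w}"
  define M where "M = switch_rel S N"
  have subM: "subcubic V E M" and K4M: "\<not> has_K4_neg V E M"
    using subcubic_switch_rel[OF sub] K4 by (simp_all add: M_def has_K4_neg_switch_rel)
  have no_colM: "\<not> (\<exists>f. coloring V E M f)"
    using no_col ex_coloring_switch_rel[of V E S N] by (auto simp: M_def)
  have nt: "negative_triangle E M a b c" if "{a, b, c} \<subseteq> V" "E a b" "E b c" "E a c" for a b c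
  proof -
    have "card (V - {a, b, c}) < card V"
      using that subcubic_finite[OF sub] by (intro psubset_card_mono) auto
    then have "\<exists>f. coloring (V - {a, b, c}) E M' f"
      if "subcubic (V - {a, b, c}) E M'" "\<not> has_K4_neg (V - {a, b, c}) E M'" for M'
      using below that unfolding colorable_below_def by blast
    then show ?thesis
      using positive_triangle_reducible[OF subM that] K4M no_colM by blast
  qed
  have ne: "u \<noteq> v" "v \<noteq> w" "u \<noteq> w" using E subcubic_irrefl[OF sub] by blast+
  have E': "E v u" "E w v" "E w u"
    using E subcubic_sym[OF sub] by blast+
  have M: "M u v" "M v w" "M u w"
    using nt[OF V E] ne by (auto simp: M_def S_def switch_rel_def negative_triangle_def)
  then have M': "M v u" "M w v" "M w u"
    using subcubic_sym_neg[OF subM] by blast+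
  have "\<exists>y\<in>V. y \<notin> {u, v, w} \<and> E u y"
    using negative_triangle_free_vertex[OF below subM K4M V E M] no_colM by blast
  then obtain x where x: "x \<in> V - {u, v, w}" "E u x" by blast
  have "\<exists>y\<in>V. y \<notin> {v, u, w} \<and> E v y"
    using negative_triangle_free_vertex[OF below subM K4M, of v u w] V E E' M M' no_colM by blast
  then obtain z where z: "z \<in> V - {u, v, w}" "E v z" by blast
  have "\<exists>y\<in>V. y \<notin> {w, v, u} \<and> E w y"
    using negative_triangle_free_vertex[OF below subM K4M, of w v u] V E E' M M' no_colM by blast
  then obtain y where y: "y \<in> V - {u, v, w}" "E w y" by blast
  show False
  proof (cases "x = y \<or> x = z \<or> y = z")
    case True
    obtain a b c d where abc: "{a, b, c, d} \<subseteq> V" "E a b" "E b c" "E a c" "E a d" "E c d" "b \<noteq> d"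
      "M a b" "M b c" "M a c"
      using True
    proof (elim disjE)
      assume "x = y"
      then show thesis using that[of u v w x] x y V E M by auto
    next
      assume "x = z"
      then show thesis using that[of u w v x] x z V E E' M M' by auto
    next
      assume "y = z"
      then show thesis using that[of v u w y] y z V E E' M M' by auto
    qed
    have acd: "negative_triangle E M a c d"
      using nt[of a c d] abc by auto
    have "\<not> E b d"
    proof
      assume "E b d"
      then have "negative_triangle E M a b c" "negative_triangle E M a b d" "negative_triangle E M b c d"
        using nt[of a b c] nt[of a b d] nt[of b c d] abc by auto
      then show False
        using acd K4M abc(1) unfolding has_K4_neg_def by blast
    qed
    then show False
      using negative_diamond_reducible[OF below subM K4M abc(1-7) _ abc(8-10) acd] no_colM by blast
  next
    case False
    have "\<exists>p q. p \<in> V - {u, v, w} \<and> q \<in> V - {u, v, w} \<and> p \<noteq> q \<and> p \<noteq> y \<and> q \<noteq> y \<and> E x p \<and> E x q \<and> E y p \<and> E y q \<and> E p q"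
      using negative_triangle_pair[OF below subM K4M V E M x y] no_colM False by blast
    then obtain p q where pq: "p \<in> V - {u, v, w}" "q \<in> V - {u, v, w}" "p \<noteq> q" "p \<noteq> y" "q \<noteq> y"
      "E x p" "E x q" "E y p" "E y q" "E p q"
      by blast
    have "\<exists>p q. p \<in> V - {u, w, v} \<and> q \<in> V - {u, w, v} \<and> p \<noteq> q \<and> p \<noteq> z \<and> q \<noteq> z \<and> E x p \<and> E x q \<and> E z p \<and> E z q"
      using negative_triangle_pair[OF below subM K4M, of u w v x z] V E E' M M' x z no_colM False by blast
    then obtain p' q' where pq': "p' \<in> V - {u, v, w}" "q' \<in> V - {u, v, w}" "p' \<noteq> q'" "p' \<noteq> z" "q' \<noteq> z"
      "E x p'" "E x q'" "E z p'" "E z q'"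
      by blast
    have "E x u" using x subcubic_sym[OF sub] by blast
    then have mem: "r \<in> {p, q}" if "r \<in> V - {u, v, w}" "E x r" for r
      using subcubic_no_four[OF sub, of x u p q r] that x V pq by auto
    then have "p \<in> {p', q'}" "q \<in> {p', q'}"
      using mem[of p'] mem[of q'] pq' by auto
    then have "p \<noteq> z" "q \<noteq> z" "E z p" using pq' by auto
    moreover have "E p x" "E p y" "E p z" "E p q"
      using pq \<open>E z p\<close> subcubic_sym[OF sub] by blast+
    moreover have "q \<noteq> x" using pq subcubic_irrefl[OF sub] by blast
    ultimately show False
      using subcubic_no_four[OF sub, of p x y z q] pq x y z False by auto
  qed
qed

subsection \<open>Triangle-free graphs\<close>

text \<open>With the fewest negative pairs, no further switching pays off, and switching
  \<open>X\<close> exchanges the signs exactly on the cut around \<open>X\<close>. Both sums count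
  cut edges from their end in \<open>X\<close>.\<close>

lemma ex_minimal_switch:
  assumes sub: "subcubic V E N"
  shows "\<exists>S. \<forall>X\<subseteq>V. (\<Sum>x\<in>X. card {y\<in>V - X. E x y \<and> switch_rel S N x y}) \<le>
    (\<Sum>x\<in>X. card {y\<in>V - X. E x y \<and> \<not> switch_rel S N x y})"
proof -
  have fin: "finite V" by (rule subcubic_finite[OF sub])
  define neg where "neg M = {(x, y). x \<in> V \<and> y \<in> V \<and> E x y \<and> M x y}" for M
  have finneg: "finite (neg M)" for M
    by (rule finite_subset[of _ "V \<times> V"]) (use fin in \<open>auto simp: neg_def\<close>)
  obtain S where S: "card (neg (switch_rel S N)) \<le> card (neg (switch_rel S' N))" for S'
    using ex_has_least_nat[of "\<lambda>_. True" _ "\<lambda>S. card (neg (switch_rel S N))"] by blast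
  define M where "M = switch_rel S N"
  have "(\<Sum>x\<in>X. card {y\<in>V - X. E x y \<and> M x y}) \<le> (\<Sum>x\<in>X. card {y\<in>V - X. E x y \<and> \<not> M x y})"
    if X: "X \<subseteq> V" for X
  proof -
    define A where "A = (SIGMA x:X. {y\<in>V - X. E x y \<and> M x y})"
    define B where "B = (SIGMA x:X. {y\<in>V - X. E x y \<and> \<not> M x y})"
    have finX: "finite X" using fin X finite_subset by blast
    have finAB: "finite A" "finite B" using fin finX by (auto simp: A_def B_def)
    have symM: "M x y \<longleftrightarrow> M y x" for x y
      using subcubic_sym_neg[OF subcubic_switch_rel[OF sub]] by (auto simp: M_def)
    \<comment> \<open>Two successive switchings amount to switching the symmetric difference, so
      minimality of \<open>S\<close> applies.\<close>
    have "switch_rel ((S - X) \<union> (X - S)) N = switch_rel X M"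
      unfolding M_def switch_rel_def by (intro ext) auto
    then have "card (neg M) \<le> card (neg (switch_rel X M))"
      using S[of "(S - X) \<union> (X - S)"] by (simp add: M_def)
    \<comment> \<open>\<open>neg\<close> consists of ordered pairs, so every cut edge appears in
      both directions; the resulting factor 2 cancels at the end.\<close>
    also have "neg (switch_rel X M) \<subseteq> (neg M - (A \<union> A\<inverse>)) \<union> (B \<union> B\<inverse>)"
      using X symM subcubic_sym[OF sub] by (auto simp: neg_def A_def B_def switch_rel_def)
    then have "card (neg (switch_rel X M)) \<le> card ((neg M - (A \<union> A\<inverse>)) \<union> (B \<union> B\<inverse>))"
      using finneg finAB by (intro card_mono) auto
    also have "\<dots> \<le> card (neg M - (A \<union> A\<inverse>)) + card (B \<union> B\<inverse>)"
      by (rule card_Un_le)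
    also have "card (neg M - (A \<union> A\<inverse>)) = card (neg M) - card (A \<union> A\<inverse>)"
      using finAB X symM subcubic_sym[OF sub] by (intro card_Diff_subset) (auto simp: neg_def A_def)
    finally have "card (neg M) \<le> card (neg M) - card (A \<union> A\<inverse>) + card (B \<union> B\<inverse>)" .
    moreover have "card (A \<union> A\<inverse>) \<le> card (neg M)"
      using finneg X symM subcubic_sym[OF sub] by (intro card_mono) (auto simp: neg_def A_def)
    moreover have "card (A \<union> A\<inverse>) = 2 * card A"
      using finAB by (subst card_Un_disjoint) (auto simp: A_def card_inverse)
    moreover have "card (B \<union> B\<inverse>) = 2 * card B"
      using finAB by (subst card_Un_disjoint) (auto simp: B_def card_inverse)
    ultimately have "card A \<le> card B" by linarith
    then show ?thesis
      using fin finX by (simp add: A_def B_def card_SigmaI)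
  qed
  then show ?thesis unfolding M_def by blast
qed

text \<open>Both ends of a matched pair describe the same set, the pair itself, so
  \<open>SOME\<close> picks the same element for both; \<open>h\<close> marks that end.\<close>

lemma ex_matching_orientation:
  fixes M :: "'v \<Rightarrow> 'v \<Rightarrow> bool"
  assumes uniq: "\<And>v y y'. M v y \<Longrightarrow> M v y' \<Longrightarrow> y = y'" and sym: "\<And>x y. M x y \<Longrightarrow> M y x"
    and irr: "\<And>x. \<not> M x x"
  shows "\<exists>h :: 'v \<Rightarrow> bool. \<forall>u v. M u v \<longrightarrow> h u \<noteq> h v"
proof -
  define h where "h v \<longleftrightarrow> v = (SOME z. z = v \<or> M v z)" for v
  have "h u \<noteq> h v" if "M u v" for u v
  proof -
    have "(z = u \<or> M u z) \<longleftrightarrow> (z = v \<or> M v z)" for z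
      using that uniq sym by blast
    then have "(SOME z. z = u \<or> M u z) = (SOME z. z = v \<or> M v z)" by simp
    moreover have "(SOME z. z = u \<or> M u z) = u \<or> M u (SOME z. z = u \<or> M u z)"
      by (rule someI[of _ u]) simp
    then have "(SOME z. z = u \<or> M u z) = u \<or> (SOME z. z = u \<or> M u z) = v"
      using uniq that by blast
    moreover have "u \<noteq> v" using that irr by blast
    ultimately show ?thesis unfolding h_def by auto
  qed
  then show ?thesis by blast
qed

text \<open>Take an orientation with the fewest \<open>P\<close>-pairs whose ends differ. If both
  ends of a matched pair were unhappy, reversing that pair would repair their \<open>P\<close>-edges
  and affect no others, as \<open>P\<close> is a matching too.\<close>

lemma ex_orientation_with_happy_ends:
  fixes M P :: "'v \<Rightarrow> 'v \<Rightarrow> bool"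
  assumes uniq: "\<And>v y y'. M v y \<Longrightarrow> M v y' \<Longrightarrow> y = y'" and sym: "\<And>x y. M x y \<Longrightarrow> M y x"
    and irr: "\<And>x. \<not> M x x"
    and uniqP: "\<And>v y y'. P v y \<Longrightarrow> P v y' \<Longrightarrow> y = y'" and symP: "\<And>x y. P x y \<Longrightarrow> P y x"
    and disj: "\<And>x y. M x y \<Longrightarrow> \<not> P x y" and fin: "finite {(x, y). P x y}"
  shows "\<exists>h :: 'v \<Rightarrow> bool. (\<forall>u v. M u v \<longrightarrow> h u \<noteq> h v) \<and>
    (\<forall>u v x y. M u v \<longrightarrow> P u x \<longrightarrow> P v y \<longrightarrow> h u = h x \<or> h v = h y)"
proof -
  define bad where "bad h = {(x, y). P x y \<and> h x \<noteq> h y}" for h :: "'v \<Rightarrow> bool"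
  have finbad: "finite (bad h)" for h
    by (rule finite_subset[OF _ fin]) (auto simp: bad_def)
  have "\<exists>h :: 'v \<Rightarrow> bool. \<forall>u v. M u v \<longrightarrow> h u \<noteq> h v"
    by (rule ex_matching_orientation) (fact uniq sym irr)+
  then obtain h0 :: "'v \<Rightarrow> bool" where "\<forall>u v. M u v \<longrightarrow> h0 u \<noteq> h0 v" ..
  from ex_has_least_nat[of "\<lambda>h. \<forall>u v. M u v \<longrightarrow> h u \<noteq> h v", OF this, of "\<lambda>h. card (bad h)"]
  obtain h where h: "\<forall>u v. M u v \<longrightarrow> h u \<noteq> h v"
    and least: "\<forall>k. (\<forall>u v. M u v \<longrightarrow> k u \<noteq> k v) \<longrightarrow> card (bad h) \<le> card (bad k)"
    by (elim exE conjE)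
  have "h u = h x \<or> h v = h y" if uv: "M u v" "P u x" "P v y" for u v x y
  proof (rule ccontr)
    assume unhappy: "\<not> ?thesis"
    define k where "k z \<longleftrightarrow> (if z = u \<or> z = v then \<not> h z else h z)" for z
    have "k s \<noteq> k t" if "M s t" for s t
    proof -
      have "s = u \<or> s = v \<longleftrightarrow> t = u \<or> t = v"
        using that uv uniq sym by blast
      then show ?thesis using h that unfolding k_def by auto
    qed
    then have valid: "\<forall>s t. M s t \<longrightarrow> k s \<noteq> k t" by blast
    have kxy: "k u = k x" "k v = k y"
    proof -
      have "x \<noteq> v" using disj[OF uv(1)] uv(2) by blast
      moreover have "y \<noteq> u" using disj[OF sym[OF uv(1)]] uv(3) by blast
      moreover have "x \<noteq> u" "y \<noteq> v" using unhappy by blast+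
      ultimately show "k u = k x" "k v = k y" using unhappy by (simp_all add: k_def)
    qed
    have "bad k \<subset> bad h"
    proof
      show "bad k \<subseteq> bad h"
      proof
        fix p assume "p \<in> bad k"
        then obtain s t where p: "p = (s, t)" "P s t" "k s \<noteq> k t" by (auto simp: bad_def)
        \<comment> \<open>The only \<open>P\<close>-edges at \<open>u\<close> and \<open>v\<close>
          go to \<open>x\<close> and \<open>y\<close>, and \<open>k\<close> makes these
          monochromatic; a pair in \<open>bad k\<close> therefore avoids \<open>u\<close> and
          \<open>v\<close>, where alone \<open>k\<close> differs from \<open>h\<close>.\<close>
        have "(s = u \<longrightarrow> t = x) \<and> (s = v \<longrightarrow> t = y) \<and> (t = u \<longrightarrow> s = x) \<and> (t = v \<longrightarrow> s = y)"
          using p(2) uv(2,3) uniqP symP by blast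
        with p(3) kxy have "s \<noteq> u" "s \<noteq> v" "t \<noteq> u" "t \<noteq> v" by metis+
        then show "p \<in> bad h" using p by (auto simp: bad_def k_def)
      qed
      have "(u, x) \<notin> bad k" "(u, x) \<in> bad h"
        using unhappy uv kxy by (auto simp: bad_def)
      then show "bad k \<noteq> bad h" by blast
    qed
    then have "card (bad k) < card (bad h)"
      by (rule psubset_card_mono[OF finbad])
    moreover have "card (bad h) \<le> card (bad k)"
      using spec[OF least, of k] valid by (rule mp)
    ultimately show False by simp
  qed
  then show ?thesis using h by blast
qed

lemma triangle_free_colorable:
  assumes sub: "subcubic V E N"
    and triangle_free: "\<And>u v w. {u, v, w} \<subseteq> V \<Longrightarrow> E u v \<Longrightarrow> E v w \<Longrightarrow> E u w \<Longrightarrow> False"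
  shows "\<exists>f. coloring V E N f"
proof -
  have fin: "finite V" by (rule subcubic_finite[OF sub])
  obtain S where S: "\<forall>X\<subseteq>V. (\<Sum>x\<in>X. card {y\<in>V - X. E x y \<and> switch_rel S N x y}) \<le>
      (\<Sum>x\<in>X. card {y\<in>V - X. E x y \<and> \<not> switch_rel S N x y})"
    using ex_minimal_switch[OF sub] by blast
  define L where "L = switch_rel S N"
  have subL: "subcubic V E L" unfolding L_def by (rule subcubic_switch_rel[OF sub])
  define n where "n X x = card {y\<in>V - X. E x y \<and> L x y}" for X x
  define p where "p X x = card {y\<in>V - X. E x y \<and> \<not> L x y}" for X x
  have cut: "(\<Sum>x\<in>X. n X x) \<le> (\<Sum>x\<in>X. p X x)" if "X \<subseteq> V" for X
    using S that by (simp add: L_def n_def p_def)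
  have degree: "n X x + p X x + card Y \<le> 3" if "x \<in> V" "Y \<subseteq> {y\<in>X \<inter> V. E x y}" for X x Y
  proof -
    have "finite Y" by (rule finite_subset[OF that(2)]) (use fin in simp)
    then have "card ({y\<in>V - X. E x y \<and> L x y} \<union> {y\<in>V - X. E x y \<and> \<not> L x y} \<union> Y) =
        card ({y\<in>V - X. E x y \<and> L x y} \<union> {y\<in>V - X. E x y \<and> \<not> L x y}) + card Y"
      using fin that by (intro card_Un_disjoint) auto
    also have "card ({y\<in>V - X. E x y \<and> L x y} \<union> {y\<in>V - X. E x y \<and> \<not> L x y}) = n X x + p X x"
      using fin unfolding n_def p_def by (intro card_Un_disjoint) auto
    finally have "n X x + p X x + card Y =
        card ({y\<in>V - X. E x y \<and> L x y} \<union> {y\<in>V - X. E x y \<and> \<not> L x y} \<union> Y)" ..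
    also have "\<dots> \<le> card {y\<in>V. E x y}"
      using fin that by (intro card_mono) auto
    finally show ?thesis using subcubic_degree[OF sub \<open>x \<in> V\<close>] by linarith
  qed
  have npos: "1 \<le> n X x" if "y \<in> V - X" "E x y" "L x y" for X x y
    using that fin unfolding n_def by (auto simp: Suc_le_eq card_gt_0_iff)
  define M where "M x y \<longleftrightarrow> x \<in> V \<and> y \<in> V \<and> E x y \<and> L x y" for x y
  \<comment> \<open>Two negative edges at \<open>v\<close> leave room for at most one positive edge,
    against the cut inequality for \<open>{v}\<close>.\<close>
  have M_uniq: "y = y'" if "M v y" "M v y'" for v y y'
  proof (rule ccontr)
    assume "y \<noteq> y'"
    then have "card {y, y'} \<le> n {v} v"
      using that fin subcubic_irrefl[OF sub] unfolding n_def M_def by (intro card_mono) auto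
    then show False
      using cut[of "{v}"] degree[of v "{}" "{v}"] that \<open>y \<noteq> y'\<close> by (simp add: M_def)
  qed
  have M_sym: "M y x" if "M x y" for x y
    using that subcubic_sym[OF sub] subcubic_sym_neg[OF subL] by (auto simp: M_def)
  define P where "P x y \<longleftrightarrow> x \<in> V \<and> y \<in> V \<and> E x y \<and> \<not> L x y \<and> (\<exists>z. M x z) \<and> (\<exists>z. M y z)" for x y
  have P_sym: "P y x" if "P x y" for x y
    using that subcubic_sym[OF sub] subcubic_sym_neg[OF subL] by (auto simp: P_def)
  \<comment> \<open>Each vertex of the positive path \<open>u\<close>, \<open>v\<close>,
    \<open>w\<close> has a negative edge leaving the path: its edges inside are positive, and
    \<open>uw\<close> is absent for lack of triangles. At most 2 + 1 + 2 edges leave, so at least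
    three negative ones face at most two positive ones, against the cut inequality.\<close>
  have P_uniq: "u = w" if vu: "P v u" and vw: "P v w" for v u w
  proof (rule ccontr)
    assume "u \<noteq> w"
    let ?X = "{u, v, w}"
    have ne: "u \<noteq> v" "w \<noteq> v"
      using that subcubic_irrefl[OF sub] by (auto simp: P_def)
    have V: "?X \<subseteq> V" using that by (auto simp: P_def)
    have E: "E u v" "E w v" "E v u" "E v w" using vu vw P_sym[OF vu] P_sym[OF vw] by (auto simp: P_def)
    have L: "\<not> L u v" "\<not> L w v" "\<not> L v u" "\<not> L v w" using vu vw P_sym[OF vu] P_sym[OF vw] by (auto simp: P_def)
    have uw: "\<not> E u w" "\<not> E w u"
      using triangle_free[of u v w] triangle_free[of w v u] V E by auto
    have "1 \<le> n ?X x" if x: "x \<in> ?X" for x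
    proof -
      obtain z where "M x z" using x vu vw by (auto simp: P_def)
      then show ?thesis
        using npos[of z ?X x] x L uw subcubic_irrefl[OF sub] by (auto simp: M_def)
    qed
    then have "1 \<le> n ?X u" "1 \<le> n ?X v" "1 \<le> n ?X w" by auto
    moreover have "n ?X u + p ?X u + card {v} \<le> 3" "n ?X w + p ?X w + card {v} \<le> 3"
      "n ?X v + p ?X v + card {u, w} \<le> 3"
      by (rule degree; use V E in auto)+
    ultimately show False
      using cut[OF V] ne \<open>u \<noteq> w\<close> by simp
  qed
  have irrM: "\<not> M x x" and disj: "M x y \<Longrightarrow> \<not> P x y" for x y
    using subcubic_irrefl[OF sub] by (auto simp: M_def P_def)
  have finP: "finite {(x, y). P x y}"
    by (rule finite_subset[of _ "V \<times> V"]) (use fin in \<open>auto simp: P_def\<close>)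
  have "\<exists>h :: 'a \<Rightarrow> bool. (\<forall>u v. M u v \<longrightarrow> h u \<noteq> h v) \<and>
      (\<forall>u v x y. M u v \<longrightarrow> P u x \<longrightarrow> P v y \<longrightarrow> h u = h x \<or> h v = h y)"
    by (rule ex_orientation_with_happy_ends) (fact M_uniq M_sym irrM P_uniq P_sym disj finP)+
  then obtain h :: "'a \<Rightarrow> bool" where h: "\<And>u v. M u v \<Longrightarrow> h u \<noteq> h v"
    and happy: "\<And>u v x y. M u v \<Longrightarrow> P u x \<Longrightarrow> P v y \<Longrightarrow> h u = h x \<or> h v = h y"
    by blast
  define unhappy where "unhappy x \<longleftrightarrow> (\<exists>y. P x y \<and> h x \<noteq> h y)" for x
  \<comment> \<open>Colour 2 is near all of 0 to 4. Low-high pairs are far apart except 1 and 3,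
    which serve positive low-high edges; \<open>happy\<close> keeps both ends of a negative edge
    from being unhappy.\<close>
  define f :: "'a \<Rightarrow> int" where "f x = (if \<not> (\<exists>z. M x z) then 2
    else if h x then (if unhappy x then 3 else 4) else (if unhappy x then 1 else 0))" for x
  have "coloring V E L f"
    unfolding coloring_def
  proof (intro ballI impI)
    fix x y assume xy: "x \<in> V" "y \<in> V" "E x y"
    show "near (f x) (f y) \<longleftrightarrow> \<not> L x y"
    proof (cases "L x y")
      case True
      then have Mxy: "M x y" using xy by (simp add: M_def)
      then have ex: "\<exists>z. M x z" "\<exists>z. M y z" using M_sym by blast+
      have "\<not> (unhappy x \<and> unhappy y)"
        using happy[OF Mxy] unfolding unhappy_def by blast
      then show ?thesis
        using True ex h[OF Mxy] by (auto simp: f_def near_def)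
    next
      case False
      show ?thesis
      proof (cases "(\<exists>z. M x z) \<and> (\<exists>z. M y z)")
        case True
        then have Pxy: "P x y" using xy False by (simp add: P_def)
        have "h x \<noteq> h y \<Longrightarrow> unhappy x \<and> unhappy y"
          using Pxy P_sym[OF Pxy] unfolding unhappy_def by metis
        then show ?thesis
          using False True by (auto simp: f_def near_def)
      next
        case False
        then show ?thesis
          using \<open>\<not> L x y\<close> by (auto simp: f_def near_def)
      qed
    qed
  qed
  then show ?thesis
    unfolding L_def using ex_coloring_switch_rel by blast
qed

lemma subcubic_colorable:
  assumes "subcubic V E N" "\<not> has_K4_neg V E N"
  shows "\<exists>f. coloring V E N f"
  using assms
proof (induction "card V" arbitrary: V E N rule: less_induct)
  case less
  then have below: "colorable_below V"
    unfolding colorable_below_def by blast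
  show ?case
    using triangle_reducible[OF below less.prems] triangle_free_colorable[OF less.prems(1)] by blast
qed

subsection \<open>Homomorphisms to the circular clique\<close>

context
  fixes G :: "('v, 'e) signed_graph"
  assumes simple: "simple_signed_graph G"
begin

definition adjacent :: "'v \<Rightarrow> 'v \<Rightarrow> bool" where
  "adjacent x y \<longleftrightarrow> (\<exists>e\<in>edges G. ends G e = {x, y})"

definition neg_adjacent :: "'v \<Rightarrow> 'v \<Rightarrow> bool" where
  "neg_adjacent x y \<longleftrightarrow> (\<exists>e\<in>edges G. ends G e = {x, y} \<and> edge_sign G e = Neg)"

lemma edge_ends:
  assumes "e \<in> edges G"
  obtains x y where "ends G e = {x, y}" "x \<noteq> y" "x \<in> vertices G" "y \<in> vertices G"
proof -
  have "card (ends G e) = 2" "ends G e \<subseteq> vertices G"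
    using assms simple by (auto simp: simple_signed_graph_def wf_signed_graph_def)
  then show thesis using that by (auto simp: card_2_iff)
qed

lemma adjacent_imp:
  assumes "adjacent x y"
  shows "x \<in> vertices G" "y \<in> vertices G" "x \<noteq> y"
proof -
  obtain e where e: "e \<in> edges G" "ends G e = {x, y}"
    using assms by (auto simp: adjacent_def)
  obtain x' y' where "ends G e = {x', y'}" "x' \<noteq> y'" "x' \<in> vertices G" "y' \<in> vertices G"
    using edge_ends[OF e(1)] .
  with e(2) show "x \<in> vertices G" "y \<in> vertices G" "x \<noteq> y"
    by (auto simp: doubleton_eq_iff)
qed

text \<open>Parallel edges of opposite signs would break this; in a simple graph \<open>ends\<close>
  is injective on the edges.\<close>

lemma edge_sign_iff:
  assumes "e \<in> edges G" "ends G e = {x, y}"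
  shows "edge_sign G e = Neg \<longleftrightarrow> neg_adjacent x y"
proof
  assume "neg_adjacent x y"
  then obtain e' where "e' \<in> edges G" "ends G e' = {x, y}" "edge_sign G e' = Neg"
    by (auto simp: neg_adjacent_def)
  moreover from this have "e' = e"
    using assms simple by (auto simp: simple_signed_graph_def inj_on_def)
  ultimately show "edge_sign G e = Neg" by simp
qed (use assms in \<open>auto simp: neg_adjacent_def\<close>)

lemma subcubic_adjacent:
  assumes "max_degree G \<le> 3"
  shows "subcubic (vertices G) adjacent neg_adjacent"
  unfolding subcubic_def
proof (intro conjI ballI)
  show fin: "finite (vertices G)"
    using simple by (auto simp: simple_signed_graph_def wf_signed_graph_def)
  show "symp adjacent" "symp neg_adjacent"
    by (auto simp: symp_def adjacent_def neg_adjacent_def insert_commute)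
  show "irreflp adjacent"
    using adjacent_imp(3) by (auto simp: irreflp_def)
  fix x assume x: "x \<in> vertices G"
  have fin_edges: "finite {e\<in>edges G. x \<in> ends G e}"
    using simple by (auto simp: simple_signed_graph_def wf_signed_graph_def)
  \<comment> \<open>Each neighbour is the other end of some edge at \<open>x\<close>, so there are
    no more neighbours than such edges.\<close>
  have "{y\<in>vertices G. adjacent x y} \<subseteq> (\<lambda>e. the_elem (ends G e - {x})) ` {e\<in>edges G. x \<in> ends G e}"
  proof
    fix y assume "y \<in> {y\<in>vertices G. adjacent x y}"
    then have "adjacent x y" by simp
    then have "x \<noteq> y" by (rule adjacent_imp)
    obtain e where e: "e \<in> edges G" "ends G e = {x, y}"
      using \<open>adjacent x y\<close> by (auto simp: adjacent_def)
    have "ends G e - {x} = {y}" using e \<open>x \<noteq> y\<close> by auto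
    then have "y = the_elem (ends G e - {x})" by simp
    then show "y \<in> (\<lambda>e. the_elem (ends G e - {x})) ` {e\<in>edges G. x \<in> ends G e}"
      using e by blast
  qed
  then have "card {y\<in>vertices G. adjacent x y} \<le> card {e\<in>edges G. x \<in> ends G e}"
    by (rule surj_card_le[OF fin_edges])
  also have "\<dots> \<le> vertex_degree G x" by (simp add: vertex_degree_def)
  also have "\<dots> \<le> max_degree G"
    unfolding max_degree_def using fin x by (intro Max_ge) auto
  finally show "card {y\<in>vertices G. adjacent x y} \<le> 3" using assms by simp
qed

text \<open>The four vertices have used up their degree 3, so by connectedness they are the whole
  graph, and every pair of vertices is an edge.\<close>

lemma K4_switching_isomorphic:
  assumes degree: "max_degree G \<le> 3" and conn: "connected_signed_graph G"
    and K4: "has_K4_neg (vertices G) adjacent neg_adjacent"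
  shows "switching_isomorphic G K4_neg"
proof -
  note sub = subcubic_adjacent[OF degree]
  obtain a b c d where abcd: "{a, b, c, d} \<subseteq> vertices G"
    and nt: "negative_triangle adjacent neg_adjacent a b c" "negative_triangle adjacent neg_adjacent a b d"
      "negative_triangle adjacent neg_adjacent a c d" "negative_triangle adjacent neg_adjacent b c d"
    using K4 unfolding has_K4_neg_def by blast
  have adj: "adjacent a b" "adjacent a c" "adjacent a d" "adjacent b c" "adjacent b d" "adjacent c d"
    using nt by (auto simp: negative_triangle_def)
  then have adj': "adjacent b a" "adjacent c a" "adjacent d a" "adjacent c b" "adjacent d b" "adjacent d c"
    using subcubic_sym[OF sub] by blast+
  have dist: "a \<noteq> b" "a \<noteq> c" "a \<noteq> d" "b \<noteq> c" "b \<noteq> d" "c \<noteq> d"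
    using adj subcubic_irrefl[OF sub] by blast+
  have closed: "y \<in> {a, b, c, d}" if "x \<in> {a, b, c, d}" "adjacent x y" for x y
  proof (rule ccontr)
    assume y: "y \<notin> {a, b, c, d}"
    have "y \<in> vertices G"
      using that(2) by (rule adjacent_imp)
    then show False
      using that y abcd adj adj' dist subcubic_no_four[OF sub, of a b c d y]
        subcubic_no_four[OF sub, of b a c d y] subcubic_no_four[OF sub, of c a b d y]
        subcubic_no_four[OF sub, of d a b c y] by auto
  qed
  have "x \<in> {a, b, c, d}" if "(a, x) \<in> (adj_rel G)\<^sup>*" for x
    using that
  proof induction
    case (step y z)
    then show ?case using closed[of y z] by (simp add: adj_rel_def adjacent_def)
  qed simp
  then have V: "vertices G = {a, b, c, d}"
    using conn abcd unfolding connected_signed_graph_def by blast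
  have all_adj: "adjacent x y" if "x \<in> vertices G" "y \<in> vertices G" "x \<noteq> y" for x y
    using that adj adj' unfolding V by auto
  \<comment> \<open>Switching \<open>S\<close> makes all edges at \<open>a\<close> negative; the
    other three follow from the negative triangles through \<open>a\<close>.\<close>
  define S where "S = {x\<in>vertices G. x \<noteq> a \<and> \<not> neg_adjacent a x}"
  have neg: "edge_sign (switch S G) e = Neg" if e: "e \<in> edges G" for e
  proof -
    obtain x y where xy: "ends G e = {x, y}" "x \<noteq> y" "x \<in> vertices G" "y \<in> vertices G"
      using edge_ends[OF e] .
    have "neg_adjacent x y \<longleftrightarrow> (x \<in> S \<longleftrightarrow> y \<in> S)"
      using xy(2-4) nt dist subcubic_sym_neg[OF sub] unfolding S_def V negative_triangle_def by auto
    then have "edge_sign G e = Neg \<longleftrightarrow> (x \<in> S \<longleftrightarrow> y \<in> S)"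
      using edge_sign_iff[OF e xy(1)] by simp
    then show ?thesis
      using xy(1) by (cases "edge_sign G e") (auto simp: switch_def)
  qed
  have "card (vertices G) = 4" using dist by (simp add: V)
  moreover have "finite (vertices G)" by (simp add: V)
  ultimately obtain f where f: "bij_betw f (vertices G) {0..<4::nat}"
    using ex_bij_betw_finite_nat by metis
  have inj: "inj_on f (vertices G)" and img: "f ` vertices G = {0..<4}"
    using f by (auto simp: bij_betw_def)
  define g where "g e = f ` ends G e" for e
  have ends_edges: "ends G ` edges G = {e. e \<subseteq> vertices G \<and> card e = 2}"
  proof
    show "ends G ` edges G \<subseteq> {e. e \<subseteq> vertices G \<and> card e = 2}"
      using simple by (auto simp: simple_signed_graph_def wf_signed_graph_def)
    show "{e. e \<subseteq> vertices G \<and> card e = 2} \<subseteq> ends G ` edges G"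
      using all_adj by (fastforce simp: card_2_iff adjacent_def)
  qed
  have "inj_on ((`) f) (Pow (vertices G))" by (rule inj_on_image_Pow[OF inj])
  then have "inj_on ((`) f) (ends G ` edges G)"
    by (rule inj_on_subset) (auto simp: ends_edges)
  moreover have "inj_on (ends G) (edges G)"
    using simple by (simp add: simple_signed_graph_def)
  ultimately have "inj_on g (edges G)"
    unfolding g_def using comp_inj_on[of "ends G" "edges G" "(`) f"] by (simp add: comp_def)
  moreover have "g ` edges G = {e. e \<subseteq> {0..<4::nat} \<and> card e = 2}"
  proof -
    have "g ` edges G = (`) f ` {e. e \<subseteq> vertices G \<and> card e = 2}"
      unfolding ends_edges[symmetric] g_def by (simp add: image_image)
    also have "\<dots> = {e. e \<subseteq> {0..<4::nat} \<and> card e = 2}"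
    proof (intro equalityI subsetI)
      fix e assume "e \<in> {e. e \<subseteq> {0..<4::nat} \<and> card e = 2}"
      then have e: "e \<subseteq> f ` vertices G" "card e = 2" by (auto simp: img)
      from e(1) obtain u where u: "u \<subseteq> vertices G" "e = f ` u"
        by (auto simp: subset_image_iff)
      then have "card u = 2"
        using e(2) card_image[OF inj_on_subset[OF inj u(1)]] by simp
      then show "e \<in> (`) f ` {e. e \<subseteq> vertices G \<and> card e = 2}" using u by blast
    next
      fix e assume "e \<in> (`) f ` {e. e \<subseteq> vertices G \<and> card e = 2}"
      then obtain u where u: "u \<subseteq> vertices G" "card u = 2" "e = f ` u" by blast
      then show "e \<in> {e. e \<subseteq> {0..<4} \<and> card e = 2}"
        using card_image[OF inj_on_subset[OF inj u(1)]] img by auto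
    qed
    finally show ?thesis .
  qed
  ultimately have "isomorphic_signed_graph (switch S G) K4_neg"
    unfolding isomorphic_signed_graph_def using f neg
    by (intro exI[of _ f] exI[of _ g]) (auto simp: K4_neg_def bij_betw_def g_def switch_def)
  moreover have "S \<subseteq> vertices G" by (auto simp: S_def)
  ultimately show ?thesis unfolding switching_isomorphic_def by blast
qed

lemma coloring_imp_hom:
  assumes f: "coloring (vertices G) adjacent neg_adjacent f"
  shows "sign_preserving_hom G (circular_clique 10 3) (\<lambda>v. f v mod 10)"
  unfolding sign_preserving_hom_def
proof (intro conjI ballI)
  show "(\<lambda>v. f v mod 10) ` vertices G \<subseteq> vertices (circular_clique 10 3)"
    by (auto simp: circular_clique_def)
  fix e assume e: "e \<in> edges G"
  obtain x y where xy: "ends G e = {x, y}" "x \<noteq> y" "x \<in> vertices G" "y \<in> vertices G"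
    using edge_ends[OF e] .
  define i j where "i = f x mod 10" and "j = f y mod 10"
  have ij: "0 \<le> i" "i < 10" "0 \<le> j" "j < 10" by (simp_all add: i_def j_def)
  have "(i - j) mod 10 = (f x - f y) mod 10"
    by (simp add: i_def j_def mod_diff_eq)
  then have "near i j \<longleftrightarrow> near (f x) (f y)"
    by (simp add: near_iff_mod)
  also have "\<dots> \<longleftrightarrow> edge_sign G e \<noteq> Neg"
    using f xy e edge_sign_iff[OF e xy(1)] unfolding coloring_def adjacent_def by blast
  finally have sign: "near i j \<longleftrightarrow> edge_sign G e \<noteq> Neg" .
  \<comment> \<open>For \<open>p = 10\<close> and \<open>q = 3\<close>, positive edges of the clique
    are those with difference at most 5 - 3 = 2 or at least 5 + 3 = 8; the negative range 3 to 7 is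
    the complement.\<close>
  have "(k + 2) mod 10 \<le> 4 \<longleftrightarrow> \<bar>k\<bar> \<le> 2 \<or> \<bar>k\<bar> \<ge> 8" if "- 10 < k" "k < 10" for k :: int
    using that by presburger
  from this[of "i - j"] have "near i j \<longleftrightarrow> \<bar>i - j\<bar> \<le> 2 \<or> \<bar>i - j\<bar> \<ge> 8"
    using ij by (simp add: near_def)
  then have "({i, j}, edge_sign G e) \<in> edges (circular_clique 10 3)"
    using ij sign by (cases "edge_sign G e") (force simp: circular_clique_def)+
  then show "\<exists>e'\<in>edges (circular_clique 10 3). ends (circular_clique 10 3) e' = (\<lambda>v. f v mod 10) ` ends G e \<and>
      edge_sign (circular_clique 10 3) e' = edge_sign G e"
    by (rule bexI[rotated]) (simp add: circular_clique_def xy(1) i_def j_def)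
qed

end

theorem theorem1p2:
  fixes G :: "('v, 'e) signed_graph"
  assumes "simple_signed_graph G"
    and "connected_signed_graph G"
    and "max_degree G = 3"
    and "\<not> switching_isomorphic G K4_neg"
  shows "circular_chromatic_number G \<le> 10 / 3"
proof -
  have degree: "max_degree G \<le> 3" using assms(3) by simp
  obtain f where "coloring (vertices G) (adjacent G) (neg_adjacent G) f"
    using subcubic_colorable[OF subcubic_adjacent[OF assms(1) degree]]
      K4_switching_isomorphic[OF assms(1) degree assms(2)] assms(4) by blast
  then have hom: "sign_preserving_hom G (circular_clique 10 3) (\<lambda>v. f v mod 10)"
    by (rule coloring_imp_hom[OF assms(1)])
  have "real_of_int 10 / real_of_int 3 \<in> circular_ratios G"
    unfolding circular_ratios_def
    by (rule CollectI, rule exI[of _ 10], rule exI[of _ 3]) (use hom in auto)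
  \<comment> \<open>The set of ratios is bounded below, so its infimum is at most its member
    10/3.\<close>
  then show ?thesis
    unfolding circular_chromatic_number_def using cInf_lower[OF _ circular_ratios_bdd_below] by fastforce
qed

end
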